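(* Let $h\in\mathbb{R}$, $\epsilon>0$, $\beta>0$ and consider Algorithm 1 (described in the context). Assume: (A1') there exists $p^*\in(0,1)$ such that $p^*\le p_t$ for every $t\in\mathbb{N}$; (A2) for every $\bm{x}\in\Omega$ and $\eta>0$ there exist $\bm{x}'\in\Omega$ and a cost $c_i$ such that $\mathrm{P}(\bm{S}(\bm{x}',c_i)\in\mathscr{N}(\bm{x};\eta))>0$, where $\mathscr{N}(\bm{x};\eta)=\{\bm{a}\in D:\|\bm{a}-\bm{x}\|<\eta\}$; (A3) for every $\bm{x}\in\Omega$, the kernel $k$ is continuous at $(\bm{x},\bm{x})$. Let $\delta\in(0,1)$ and let $T^*$ be the smallest positive integer satisfying $T^*>2\beta\sigma^2\epsilon^{-2}$. Let $\nu$ be a positive number such that $$\forall \bm{x}\in\Omega,\ \forall \bm{a}^{(T^* )}=(\bm{a}_1,\dots,\bm{a}_{T^*})\in\mathscr{N}(\bm{x};\nu)^{T^*}:\quad \big|\varsigma^2_{T^*}(\bm{x})-\varsigma^2_{\bm{a}^{(T^* )}}(\bm{x})\big|<\frac{\epsilon^2}{2\beta},$$ define the positive probabilities $$\tilde p_{\bm{x}}=\sum_{\bm{a}\in\Omega}\sum_{i=1}^K\kappa_i\,\mathrm{P}\big(\bm{S}(\bm{a},c_i)\in\mathscr{N}(\bm{x};\nu)\big)\quad(\bm{x}\in\Omega),\qquad \tilde p^*=\min_{\bm{x}\in\Omega}\tilde p_{\bm{x}},$$ and let $p=p^*\tilde p^*$. Let $r$ be the smallest positive integer satisfying $$r>\frac{\log(|\Omega|\,T^*\delta^{-1})}{-\log(1-p)}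 .$$ Then, with probability at least $1-\delta$, Algorithm 1 completes after at most $r|\Omega|T^*$ trials.
   Context: Setting. $D\subset\mathbb{R}^d$, $\Omega\subset D$ is a nonempty finite set, and $f:D\to\mathbb{R}$ is a black-box function modelled with a Gaussian process prior $\mathcal{GP}(0,k)$ with positive-definite kernel $k:D\times D\to\mathbb{R}$. There are costs $0<c_1<\dots<c_K$. If the point $\bm{x}\in\Omega$ is requested with cost $c_i$, the point actually evaluated is a random sample $\bm{s}\in D$ of a random variable $\bm{S}(\bm{x},c_i)$ with density $g(\cdot\mid\theta_{\bm{x}}^{(c_i)})$, and one observes $\bm{s}$ and $y=f(\bm{s})+\varrho$ with independent noise $\varrho\sim\mathcal{N}(0,\sigma^2)$, $\sigma^2>0$. Posterior. After $t$ trials with evaluated points $\bm{s}_1,\dots,\bm{s}_t$ and observations $\bm{y}_t=(y_1,\dots,y_t)^\top$, put $\bm{k}_t(\bm{x})=(k(\bm{s}_1,\bm{x}),\dots,k(\bm{s}_t,\bm{x}))^\top$, $\bm{K}_t=(k(\bm{s}_i,\bm{s}_j))_{i,j}$, $\bm{C}_t=\bm{K}_t+\sigma^2\bm{I}_t$, and $\mu_t(\bm{x})=\bm{k}_t(\bm{x})^\top\bm{C}_t^{-1}\bm{y}_t$, $k_t(\bm{x},\bm{x}')=k(\bm{x},\bm{x}')-\bm{k}_t(\bm{x})^\top\bm{C}_t^{-1}\bm{k}_t(\bm{x}')$, $\sigma_t^2(\bm{x})=k_t(\bm{x},\bm{x})$. (If a finite, possibly empty, set of initial training data from the same observation model is supplied,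 it is included in the conditioning as well.) Classification. Let $l_t(\bm{x})=\mu_t(\bm{x})-\beta^{1/2}\sigma_t(\bm{x})$, $u_t(\bm{x})=\mu_t(\bm{x})+\beta^{1/2}\sigma_t(\bm{x})$, and $H_t=\{\bm{x}\in\Omega: l_t(\bm{x})>h-\epsilon\}$, $L_t=\{\bm{x}\in\Omega: u_t(\bm{x})<h+\epsilon\}$, $U_t=\Omega\setminus(H_t\cup L_t)$ for $t\ge1$, with $U_0=\Omega$. Acquisition function. For a hypothetical new data point $(\bm{s}^*,y^* )$, let $HL_t(\bm{s}^*,y^* )$ be the union of the two estimated sets recomputed after adding $(\bm{s}^*,y^* )$ to the current data, let $HL_t=H_t\cup L_t$, and $a_t(\bm{x},c_i)=c_i^{-1}\big\{\int \mathrm{E}_{y^*}\big[|HL_t(\bm{s}^*,y^* )|\big]\,g(\bm{s}^*\mid\theta_{\bm{x}}^{(c_i)})\,d\bm{s}^*-|HL_t|\big\}$, where $y^*\sim\mathcal{N}(\mu_t(\bm{s}^* ),\sigma_t^2(\bm{s}^* )+\sigma^2)$. Algorithm 1. Given $p_1,p_2,\dots\in[0,1]$ and $\kappa_1,\dots,\kappa_K\in(0,1)$ with $|\Omega|\sum_{i=1}^K\kappa_i=1$. As long as $U_{t-1}\neq\emptyset$, trial $t$ is performed: draw independently $r_t\sim$ Bernoulli$(p_t)$; if $r_t=0$ choose $(\bm{x}_t,c_{i_t})$ maximizing the acquisition function (computed from the current data) over $\Omega\times\{c_1,\dots,c_K\}$; if $r_t=1$ draw $(\bm{x}_t,c_{i_t})=C_t$,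 where, independently of everything else, $\mathrm{P}(C_t=(\bm{x},c_i))=\kappa_i$ for each $\bm{x}\in\Omega$ and each $i$. Then sample $\bm{s}_t$ from $\bm{S}(\bm{x}_t,c_{i_t})$ (independently of the past given $(\bm{x}_t,c_{i_t})$), observe $y_t=f(\bm{s}_t)+\varrho_t$, and update. The algorithm completes after $t$ trials if $t$ is the first index with $U_t=\emptyset$. Auxiliary variances. For $t\ge1$ and $\bm{x}\in\Omega$, with $\bm{1}_t$ the all-ones vector, $\varsigma_t^2(\bm{x})=k(\bm{x},\bm{x})-(k(\bm{x},\bm{x})\bm{1}_t)^\top\big(k(\bm{x},\bm{x})\bm{1}_t\bm{1}_t^\top+\sigma^2\bm{I}_t\big)^{-1}(k(\bm{x},\bm{x})\bm{1}_t)$. For a tuple $\bm{x}^{(t)}=(\bm{x}_1,\dots,\bm{x}_t)$ of points of $D$, $\varsigma^2_{\bm{x}^{(t)}}(\bm{x})=k(\bm{x},\bm{x})-\bm{k}_{\bm{x}^{(t)}}(\bm{x})^\top(\bm{K}_{\bm{x}^{(t)}}+\sigma^2\bm{I}_t)^{-1}\bm{k}_{\bm{x}^{(t)}}(\bm{x})$, where $\bm{k}_{\bm{x}^{(t)}}(\bm{x})$ has $i$th entry $k(\bm{x}_i,\bm{x})$ and $\bm{K}_{\bm{x}^{(t)}}$ has $(i,j)$ entry $k(\bm{x}_i,\bm{x}_j)$. *)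

theory Defs
  imports
    "HOL-Probability.Probability"
    "Jordan_Normal_Form.Gauss_Jordan_Elimination"
begin

definition nbhd :: "'a::real_normed_vector set \<Rightarrow> 'a \<Rightarrow> real \<Rightarrow> 'a set" where
  "nbhd D x \<eta> = {a \<in> D. norm (a - x) < \<eta>}"

text \<open>Only the values of a kernel on \<open>D \<times> D\<close> are meaningful. As usual for covariance functions,
  positive-definiteness includes symmetry and allows degenerate Gram matrices.\<close>

definition pos_def_kernel :: "'a set \<Rightarrow> ('a \<Rightarrow> 'a \<Rightarrow> real) \<Rightarrow> bool" where
  "pos_def_kernel D k \<longleftrightarrow>
     (\<forall>x\<in>D. \<forall>y\<in>D. k x y = k y x) \<and>
     (\<forall>A b. finite A \<and> A \<subseteq> D \<longrightarrow> 0 \<le> (\<Sum>x\<in>A. \<Sum>y\<in>A. b x * b y * k x y))"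

text \<open>The parameter \<open>\<sigma>\<close> is the standard deviation of the noise. The inverses below always exist for a
  positive-definite kernel and \<open>\<sigma> > 0\<close>, so the value of \<open>the None\<close> plays no role.\<close>

definition minv :: "real mat \<Rightarrow> real mat" where
  "minv A = the (mat_inverse A)"

definition kvec :: "('a \<Rightarrow> 'a \<Rightarrow> real) \<Rightarrow> 'a list \<Rightarrow> 'a \<Rightarrow> real vec" where
  "kvec k xs x = Matrix.vec (length xs) (\<lambda>i. k (xs ! i) x)"

definition gram :: "('a \<Rightarrow> 'a \<Rightarrow> real) \<Rightarrow> 'a list \<Rightarrow> real mat" where
  "gram k xs = Matrix.mat (length xs) (length xs) (\<lambda>(i, j). k (xs ! i) (xs ! j))"

definition noisy_gram :: "('a \<Rightarrow> 'a \<Rightarrow> real) \<Rightarrow> real \<Rightarrow> 'a list \<Rightarrow> real mat" where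
  "noisy_gram k \<sigma> xs = gram k xs + \<sigma>\<^sup>2 \<cdot>\<^sub>m 1\<^sub>m (length xs)"

definition post_cov :: "('a \<Rightarrow> 'a \<Rightarrow> real) \<Rightarrow> real \<Rightarrow> 'a list \<Rightarrow> 'a \<Rightarrow> 'a \<Rightarrow> real" where
  "post_cov k \<sigma> xs x x' =
     k x x' - scalar_prod (kvec k xs x) (minv (noisy_gram k \<sigma> xs) *\<^sub>v kvec k xs x')"

definition post_var :: "('a \<Rightarrow> 'a \<Rightarrow> real) \<Rightarrow> real \<Rightarrow> 'a list \<Rightarrow> 'a \<Rightarrow> real" where
  "post_var k \<sigma> xs x = post_cov k \<sigma> xs x x"

text \<open>A data set is a list of pairs (evaluated point, observation).\<close>

definition post_mean :: "('a \<Rightarrow> 'a \<Rightarrow> real) \<Rightarrow> real \<Rightarrow> ('a \<times> real) list \<Rightarrow> 'a \<Rightarrow> real" where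
  "post_mean k \<sigma> d x =
     scalar_prod (kvec k (map fst d) x)
       (minv (noisy_gram k \<sigma> (map fst d)) *\<^sub>v vec_of_list (map snd d))"

definition post_sd :: "('a \<Rightarrow> 'a \<Rightarrow> real) \<Rightarrow> real \<Rightarrow> ('a \<times> real) list \<Rightarrow> 'a \<Rightarrow> real" where
  "post_sd k \<sigma> d x = sqrt (post_var k \<sigma> (map fst d) x)"

text \<open>The variance after \<open>t\<close> (hypothetical) evaluations exactly at \<open>x\<close>.\<close>

definition repeated_var :: "('a \<Rightarrow> 'a \<Rightarrow> real) \<Rightarrow> real \<Rightarrow> nat \<Rightarrow> 'a \<Rightarrow> real" where
  "repeated_var k \<sigma> t x =
     (let ones = Matrix.vec t (\<lambda>_. 1);
          ones_mat = Matrix.mat t t (\<lambda>_. 1)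
      in k x x - scalar_prod (k x x \<cdot>\<^sub>v ones)
           (minv (k x x \<cdot>\<^sub>m ones_mat + \<sigma>\<^sup>2 \<cdot>\<^sub>m 1\<^sub>m t) *\<^sub>v (k x x \<cdot>\<^sub>v ones)))"

definition lower_bd :: "('a \<Rightarrow> 'a \<Rightarrow> real) \<Rightarrow> real \<Rightarrow> real \<Rightarrow> ('a \<times> real) list \<Rightarrow> 'a \<Rightarrow> real" where
  "lower_bd k \<sigma> \<beta> d x = post_mean k \<sigma> d x - sqrt \<beta> * post_sd k \<sigma> d x"

definition upper_bd :: "('a \<Rightarrow> 'a \<Rightarrow> real) \<Rightarrow> real \<Rightarrow> real \<Rightarrow> ('a \<times> real) list \<Rightarrow> 'a \<Rightarrow> real" where
  "upper_bd k \<sigma> \<beta> d x = post_mean k \<sigma> d x + sqrt \<beta> * post_sd k \<sigma> d x"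

definition H_set where
  "H_set k \<sigma> \<beta> h \<epsilon> \<Omega> d = {x \<in> \<Omega>. lower_bd k \<sigma> \<beta> d x > h - \<epsilon>}"

definition L_set where
  "L_set k \<sigma> \<beta> h \<epsilon> \<Omega> d = {x \<in> \<Omega>. upper_bd k \<sigma> \<beta> d x < h + \<epsilon>}"

definition HL_set where
  "HL_set k \<sigma> \<beta> h \<epsilon> \<Omega> d = H_set k \<sigma> \<beta> h \<epsilon> \<Omega> d \<union> L_set k \<sigma> \<beta> h \<epsilon> \<Omega> d"

text \<open>Here \<open>dat t\<close> is the data set after \<open>t\<close> trials; \<open>U\<^sub>0 = \<Omega>\<close> even if initial data are present.\<close>

definition U_set :: "('a \<Rightarrow> 'a \<Rightarrow> real) \<Rightarrow> real \<Rightarrow> real \<Rightarrow> real \<Rightarrow> real \<Rightarrow> 'a set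
    \<Rightarrow> (nat \<Rightarrow> ('a \<times> real) list) \<Rightarrow> nat \<Rightarrow> 'a set" where
  "U_set k \<sigma> \<beta> h \<epsilon> \<Omega> dat t = (if t = 0 then \<Omega> else \<Omega> - HL_set k \<sigma> \<beta> h \<epsilon> \<Omega> (dat t))"

definition performed :: "('a \<Rightarrow> 'a \<Rightarrow> real) \<Rightarrow> real \<Rightarrow> real \<Rightarrow> real \<Rightarrow> real \<Rightarrow> 'a set
    \<Rightarrow> (nat \<Rightarrow> ('a \<times> real) list) \<Rightarrow> nat \<Rightarrow> bool" where
  "performed k \<sigma> \<beta> h \<epsilon> \<Omega> dat t \<longleftrightarrow> (\<forall>j<t. U_set k \<sigma> \<beta> h \<epsilon> \<Omega> dat j \<noteq> {})"

definition completes_after :: "('a \<Rightarrow> 'a \<Rightarrow> real) \<Rightarrow> real \<Rightarrow> real \<Rightarrow> real \<Rightarrow> real \<Rightarrow> 'a set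
    \<Rightarrow> (nat \<Rightarrow> ('a \<times> real) list) \<Rightarrow> nat \<Rightarrow> bool" where
  "completes_after k \<sigma> \<beta> h \<epsilon> \<Omega> dat t \<longleftrightarrow>
     U_set k \<sigma> \<beta> h \<epsilon> \<Omega> dat t = {} \<and> (\<forall>j<t. U_set k \<sigma> \<beta> h \<epsilon> \<Omega> dat j \<noteq> {})"

abbreviation normal_measure :: "real \<Rightarrow> real \<Rightarrow> real measure" where
  "normal_measure m s \<equiv> density lborel (\<lambda>y. ennreal (normal_density m s y))"

text \<open>Expected number of classified points after adding the datum \<open>(s, y)\<close>, where \<open>y\<close> follows the
  posterior predictive distribution at \<open>s\<close>.\<close>

definition expected_HL :: "('a \<Rightarrow> 'a \<Rightarrow> real) \<Rightarrow> real \<Rightarrow> real \<Rightarrow> real \<Rightarrow> real \<Rightarrow> 'a set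
    \<Rightarrow> ('a \<times> real) list \<Rightarrow> 'a \<Rightarrow> real" where
  "expected_HL k \<sigma> \<beta> h \<epsilon> \<Omega> d s =
     (\<integral>y. real (card (HL_set k \<sigma> \<beta> h \<epsilon> \<Omega> (d @ [(s, y)])))
        \<partial>normal_measure (post_mean k \<sigma> d s) (sqrt (post_var k \<sigma> (map fst d) s + \<sigma>\<^sup>2)))"

text \<open>Acquisition value of a request with cost \<open>cost\<close> and sampling density \<open>dens\<close>, given data \<open>d\<close>
  and the currently classified set \<open>HL\<close>.\<close>

definition acquisition :: "('a::euclidean_space \<Rightarrow> 'a \<Rightarrow> real) \<Rightarrow> real \<Rightarrow> real \<Rightarrow> real \<Rightarrow> real
    \<Rightarrow> 'a set \<Rightarrow> 'a set \<Rightarrow> ('a \<times> real) list \<Rightarrow> 'a set \<Rightarrow> real \<Rightarrow> ('a \<Rightarrow> real) \<Rightarrow> real" where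
  "acquisition k \<sigma> \<beta> h \<epsilon> \<Omega> D d HL cost dens =
     inverse cost * ((LINT s:D|lborel. expected_HL k \<sigma> \<beta> h \<epsilon> \<Omega> d s * dens s) - real (card HL))"

text \<open>\<open>S x c\<close> is the random point evaluated when \<open>x\<close> is requested with cost \<open>c\<close>; it lives on the
  probability space \<open>N\<close> and only its distribution matters. Its density, the member of the parametric
  family with parameter \<open>\<theta>\<close> belonging to \<open>x\<close> and \<open>c\<close>, is \<open>g x c\<close>. Borel measurability of the kernel
  makes the posterior quantities random variables.\<close>

locale lse_setting = N: prob_space N
  for D :: "'a::euclidean_space set" and \<Omega> :: "'a set"
    and k :: "'a \<Rightarrow> 'a \<Rightarrow> real" and \<sigma> :: real
    and K :: nat and c :: "nat \<Rightarrow> real"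
    and N :: "'v measure" and S :: "'a \<Rightarrow> real \<Rightarrow> 'v \<Rightarrow> 'a" and g :: "'a \<Rightarrow> real \<Rightarrow> 'a \<Rightarrow> real" +
  assumes cand: "\<Omega> \<subseteq> D" "finite \<Omega>" "\<Omega> \<noteq> {}"
    and kernel: "pos_def_kernel D k"
    and kernel_measurable:
      "(\<lambda>(x, y). k x y) \<in> borel_measurable (restrict_space borel D \<Otimes>\<^sub>M restrict_space borel D)"
    and noise_sd: "\<sigma> > 0"
    and cost_pos: "\<And>i. i \<in> {1..K} \<Longrightarrow> 0 < c i"
    and cost_mono: "strict_mono_on {1..K} c"
    and dens_nonneg: "\<And>x i s. x \<in> \<Omega> \<Longrightarrow> i \<in> {1..K} \<Longrightarrow> 0 \<le> g x (c i) s"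
    and S_distr: "\<And>x i. x \<in> \<Omega> \<Longrightarrow> i \<in> {1..K} \<Longrightarrow>
      distributed N lborel (S x (c i)) (\<lambda>s. ennreal (g x (c i) s))"
    and S_in_D: "\<And>x i v. x \<in> \<Omega> \<Longrightarrow> i \<in> {1..K} \<Longrightarrow> v \<in> space N \<Longrightarrow> S x (c i) v \<in> D"

text \<open>A run of the algorithm on a probability space \<open>M\<close>.

  \<^item> \<open>f \<omega>\<close> is the black-box function. Neither a particular function nor a particular law is imposed:
    a constant \<open>f\<close> is a fixed deterministic function, and a measurable Gaussian process is also an instance.
  \<^item> The \<open>n0\<close> initial data have points \<open>s0 j\<close> and noise \<open>e0 j\<close>, \<open>j < n0\<close>; \<open>E j\<close> is the information
    available when the \<open>j\<close>-th of them is observed (its point included, its noise excluded).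
  \<^item> Trial \<open>t \<ge> 1\<close> has Bernoulli variable \<open>r t\<close>, random request \<open>C t\<close>, actual request
    \<open>req t\<close> (a point and the index of a cost), evaluated point \<open>s t\<close> and noise \<open>e t\<close>. \<open>F t\<close> is the
    information after \<open>t\<close> trials, and \<open>G t\<close> that of trial \<open>t\<close> once its request is fixed.
  \<^item> The rules of the algorithm are imposed only on the event that the trial is performed; the
    variables of trials that are not performed are arbitrary dummies.
  \<^item> Conditional distributions are expressed by probabilities of intersections with past events \<open>A\<close>.
  \<^item> The sets \<open>H\<^sub>t\<close> and \<open>L\<^sub>t\<close> are given by the confidence bounds for \<open>t \<ge> 1\<close> only. The classified set
    \<open>HL0\<close> used as reference in trial 1 is therefore left open, which admits both the empty set and the
    set computed from the initial data.\<close>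

locale lse_run =
  lse_setting D \<Omega> k \<sigma> K c N S g + M: prob_space M
  for D :: "'a::euclidean_space set" and \<Omega> :: "'a set"
    and k :: "'a \<Rightarrow> 'a \<Rightarrow> real" and \<sigma> :: real
    and K :: nat and c :: "nat \<Rightarrow> real"
    and N :: "'v measure" and S :: "'a \<Rightarrow> real \<Rightarrow> 'v \<Rightarrow> 'a" and g :: "'a \<Rightarrow> real \<Rightarrow> 'a \<Rightarrow> real"
    and \<beta> h \<epsilon> :: real
    and p :: "nat \<Rightarrow> real" and \<kappa> :: "nat \<Rightarrow> real"
    and M :: "'w measure" and f :: "'w \<Rightarrow> 'a \<Rightarrow> real"
    and n0 :: nat and E :: "nat \<Rightarrow> 'w measure"
    and s0 :: "nat \<Rightarrow> 'w \<Rightarrow> 'a" and e0 :: "nat \<Rightarrow> 'w \<Rightarrow> real"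
    and F G :: "nat \<Rightarrow> 'w measure"
    and r :: "nat \<Rightarrow> 'w \<Rightarrow> bool" and C req :: "nat \<Rightarrow> 'w \<Rightarrow> 'a \<times> nat"
    and s :: "nat \<Rightarrow> 'w \<Rightarrow> 'a" and e :: "nat \<Rightarrow> 'w \<Rightarrow> real"
    and HL0 :: "'w \<Rightarrow> 'a set" and dat :: "nat \<Rightarrow> 'w \<Rightarrow> ('a \<times> real) list" +
  assumes p_range: "\<And>t. t \<ge> 1 \<Longrightarrow> p t \<in> {0..1}"
    and \<kappa>_range: "\<And>i. i \<in> {1..K} \<Longrightarrow> \<kappa> i \<in> {0<..<1}"
    and \<kappa>_sum: "real (card \<Omega>) * (\<Sum>i=1..K. \<kappa> i) = 1"
    and E_mono: "\<And>j. j < n0 \<Longrightarrow> subalgebra (E (Suc j)) (E j)"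
    and F_0: "subalgebra (F 0) (E n0)"
    and G_past: "\<And>t. t \<ge> 1 \<Longrightarrow> subalgebra (G t) (F (t - 1))"
    and F_step: "\<And>t. t \<ge> 1 \<Longrightarrow> subalgebra (F t) (G t)"
    and F_sub: "\<And>t. subalgebra M (F t)"
    and f_measurable: "(\<lambda>(\<omega>, x). f \<omega> x) \<in> borel_measurable (E 0 \<Otimes>\<^sub>M restrict_space borel D)"
    and s0_measurable: "\<And>j. j < n0 \<Longrightarrow> s0 j \<in> measurable (E j) (restrict_space borel D)"
    and e0_measurable: "\<And>j. j < n0 \<Longrightarrow> e0 j \<in> borel_measurable (E (Suc j))"
    and e0_law: "\<And>j A B. j < n0 \<Longrightarrow> A \<in> sets (E j) \<Longrightarrow> B \<in> sets borel \<Longrightarrow>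
      measure M {\<omega> \<in> A. e0 j \<omega> \<in> B} = measure M A * measure (normal_measure 0 \<sigma>) B"
    and r_measurable: "\<And>t. t \<ge> 1 \<Longrightarrow> r t \<in> measurable (G t) (count_space UNIV)"
    and C_measurable: "\<And>t. t \<ge> 1 \<Longrightarrow> C t \<in> measurable (G t) (count_space (\<Omega> \<times> {1..K}))"
    and req_measurable: "\<And>t. t \<ge> 1 \<Longrightarrow> req t \<in> measurable (G t) (count_space (\<Omega> \<times> {1..K}))"
    and s_measurable: "\<And>t. t \<ge> 1 \<Longrightarrow> s t \<in> measurable (F t) (restrict_space borel D)"
    and e_measurable: "\<And>t. t \<ge> 1 \<Longrightarrow> e t \<in> borel_measurable (F t)"
    and HL0_sub: "\<And>\<omega>. \<omega> \<in> space M \<Longrightarrow> HL0 \<omega> \<subseteq> \<Omega>"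
    and dat_0: "\<And>\<omega>. \<omega> \<in> space M \<Longrightarrow>
      dat 0 \<omega> = map (\<lambda>j. (s0 j \<omega>, f \<omega> (s0 j \<omega>) + e0 j \<omega>)) [0..<n0]"
    and dat_step: "\<And>t \<omega>. t \<ge> 1 \<Longrightarrow> \<omega> \<in> space M \<Longrightarrow>
      dat t \<omega> = dat (t - 1) \<omega> @ [(s t \<omega>, f \<omega> (s t \<omega>) + e t \<omega>)]"
    and draw_law: "\<And>t A b x i. t \<ge> 1 \<Longrightarrow> A \<in> sets (F (t - 1)) \<Longrightarrow>
      (\<And>\<omega>. \<omega> \<in> A \<Longrightarrow> performed k \<sigma> \<beta> h \<epsilon> \<Omega> (\<lambda>j. dat j \<omega>) t) \<Longrightarrow>
      x \<in> \<Omega> \<Longrightarrow> i \<in> {1..K} \<Longrightarrow>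
      measure M {\<omega> \<in> A. r t \<omega> = b \<and> C t \<omega> = (x, i)} =
        measure M A * (if b then p t else 1 - p t) * \<kappa> i"
    and req_random: "\<And>t \<omega>. t \<ge> 1 \<Longrightarrow> \<omega> \<in> space M \<Longrightarrow>
      performed k \<sigma> \<beta> h \<epsilon> \<Omega> (\<lambda>j. dat j \<omega>) t \<Longrightarrow> r t \<omega> \<Longrightarrow> req t \<omega> = C t \<omega>"
    and req_max: "\<And>t \<omega>. t \<ge> 1 \<Longrightarrow> \<omega> \<in> space M \<Longrightarrow>
      performed k \<sigma> \<beta> h \<epsilon> \<Omega> (\<lambda>j. dat j \<omega>) t \<Longrightarrow> \<not> r t \<omega> \<Longrightarrow>
      is_arg_max
        (\<lambda>(x, i). acquisition k \<sigma> \<beta> h \<epsilon> \<Omega> D (dat (t - 1) \<omega>)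
           (if t = 1 then HL0 \<omega> else HL_set k \<sigma> \<beta> h \<epsilon> \<Omega> (dat (t - 1) \<omega>)) (c i) (g x (c i)))
        (\<lambda>q. q \<in> \<Omega> \<times> {1..K}) (req t \<omega>)"
    and sample_law: "\<And>t A x i B B'. t \<ge> 1 \<Longrightarrow> A \<in> sets (G t) \<Longrightarrow>
      (\<And>\<omega>. \<omega> \<in> A \<Longrightarrow> performed k \<sigma> \<beta> h \<epsilon> \<Omega> (\<lambda>j. dat j \<omega>) t) \<Longrightarrow>
      x \<in> \<Omega> \<Longrightarrow> i \<in> {1..K} \<Longrightarrow> B \<in> sets borel \<Longrightarrow> B' \<in> sets borel \<Longrightarrow>
      measure M {\<omega> \<in> A. req t \<omega> = (x, i) \<and> s t \<omega> \<in> B \<and> e t \<omega> \<in> B'} =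
        measure M {\<omega> \<in> A. req t \<omega> = (x, i)}
          * measure N {v \<in> space N. S x (c i) v \<in> B} * measure (normal_measure 0 \<sigma>) B'"

end

theory Submission
  imports Defs "Jordan_Normal_Form.Determinant"
begin

text \<open>Write \<open>B\<close> for the ball of radius \<open>\<nu>\<close> around a candidate \<open>x\<close>. The posterior variance is the least
  mean square error of a linear predictor, so it decreases when points are added, and at \<open>x\<close> it is
  below \<open>\<epsilon>\<^sup>2 / \<beta>\<close> once \<open>T_star\<close> of the evaluated points lie in \<open>B\<close>; then \<open>x\<close> is classified, whatever the
  observations are. Conditionally on the past, a performed trial evaluates a point of \<open>B\<close> with
  probability at least \<open>q\<close>, because it is a random request with probability at least \<open>p_star\<close>. Assign
  to each candidate \<open>T_star\<close> disjoint blocks of \<open>R\<close> consecutive trials. A run that does not stop in time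
  must miss the ball of some candidate throughout one of its blocks; a given block is missed with
  probability at most \<open>(1 - q) ^ R\<close>, and the union bound gives the claim.\<close>

section \<open>Posterior variance\<close>

unbundle no vec_syntax

text \<open>The adjugate formula writes each entry of the inverse as a quotient of polynomials in
  the entries of \<open>A\<close>, from which measurability of the posterior follows later. Since
  \<open>minv\<close> goes through \<open>mat_inverse\<close>, the nonzero determinant first has to
  rule out the outcome \<open>None\<close>.\<close>

lemma minv_eq_adj:
  fixes A :: "real mat"
  assumes A: "A \<in> carrier_mat n n" and det: "Determinant.det A \<noteq> 0"
  shows "minv A \<in> carrier_mat n n" and "A * minv A = 1\<^sub>m n"
    and "minv A = inverse (Determinant.det A) \<cdot>\<^sub>m adj_mat A"
proof -
  have "A \<in> Units (ring_mat TYPE(real) n ())"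
    using det_non_zero_imp_unit[OF A det] .
  then obtain B where B: "mat_inverse A = Some B"
    using mat_inverse(1)[OF A, of "()"] by (cases "mat_inverse A") auto
  have inv: "A * B = 1\<^sub>m n" "B * A = 1\<^sub>m n" "B \<in> carrier_mat n n"
    using mat_inverse(2)[OF A B] by auto
  have minv: "minv A = B"
    by (simp add: minv_def B)
  show "minv A \<in> carrier_mat n n" "A * minv A = 1\<^sub>m n"
    using inv minv by auto
  let ?d = "Determinant.det A" and ?J = "adj_mat A"
  have J: "?J \<in> carrier_mat n n" by (rule adj_mat(1)[OF A])
  have "?d \<cdot>\<^sub>m B = B * (?d \<cdot>\<^sub>m 1\<^sub>m n)"
    using inv by (simp add: mult_smult_distrib[of _ n n _ n])
  also have "\<dots> = B * (A * ?J)"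
    by (simp add: adj_mat(2)[OF A])
  also have "\<dots> = ?J"
    using inv A J by (simp flip: assoc_mult_mat[of _ n n _ n _ n])
  finally have "inverse ?d \<cdot>\<^sub>m (?d \<cdot>\<^sub>m B) = inverse ?d \<cdot>\<^sub>m ?J"
    by simp
  moreover have "inverse ?d \<cdot>\<^sub>m (?d \<cdot>\<^sub>m B) = B"
    using det by (intro eq_matI) auto
  ultimately show "minv A = inverse ?d \<cdot>\<^sub>m ?J"
    using minv by simp
qed

section \<open>Kernel forms and nonsingularity of noisy Gram matrices\<close>

lemma kernel_sym: "pos_def_kernel D k \<Longrightarrow> x \<in> D \<Longrightarrow> y \<in> D \<Longrightarrow> k x y = k y x"
  by (simp add: pos_def_kernel_def)

text \<open>Positive-definiteness quantifies over sets of distinct points, whereas evaluated points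
  may repeat. Adding up the weights \<open>w\<close> over equal list entries, as \<open>?b\<close>
  does, turns the double sum over positions into one over points.\<close>

lemma kernel_form_nonneg:
  fixes xs :: "'a list"
  assumes k: "pos_def_kernel D k" and xs: "set xs \<subseteq> D"
  shows "0 \<le> (\<Sum>i<length xs. \<Sum>j<length xs. w i * w j * k (xs ! i) (xs ! j))"
proof -
  let ?I = "{..<length xs}" and ?b = "\<lambda>x. \<Sum>i\<in>{i. i < length xs \<and> xs ! i = x}. w i"
  have fib: "(\<Sum>x\<in>set xs. \<Sum>i\<in>{i. i < length xs \<and> xs ! i = x}. g i) = (\<Sum>i\<in>?I. g i)"
    for g :: "nat \<Rightarrow> real"
    using sum.group[of ?I "set xs" "(!) xs" g] by (auto simp: image_subset_iff)
  have "0 \<le> (\<Sum>x\<in>set xs. \<Sum>y\<in>set xs. ?b x * ?b y * k x y)"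
    using k xs unfolding pos_def_kernel_def by (simp add: finite_set)
  also have "\<dots> = (\<Sum>x\<in>set xs. \<Sum>i\<in>{i. i < length xs \<and> xs ! i = x}.
       \<Sum>y\<in>set xs. \<Sum>j\<in>{j. j < length xs \<and> xs ! j = y}. w i * w j * k (xs ! i) (xs ! j))"
  proof (intro sum.cong refl)
    fix x
    have "(\<Sum>y\<in>set xs. ?b x * ?b y * k x y) =
       (\<Sum>y\<in>set xs. \<Sum>i\<in>{i. i < length xs \<and> xs ! i = x}.
         \<Sum>j\<in>{j. j < length xs \<and> xs ! j = y}. w i * w j * k (xs ! i) (xs ! j))"
      by (intro sum.cong refl) (auto simp: sum_product sum_distrib_left sum_distrib_right mult_ac)
    then show "(\<Sum>y\<in>set xs. ?b x * ?b y * k x y) =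
       (\<Sum>i\<in>{i. i < length xs \<and> xs ! i = x}. \<Sum>y\<in>set xs.
         \<Sum>j\<in>{j. j < length xs \<and> xs ! j = y}. w i * w j * k (xs ! i) (xs ! j))"
      by (simp add: sum.swap[of _ "set xs"])
  qed
  also have "\<dots> = (\<Sum>i<length xs. \<Sum>j<length xs. w i * w j * k (xs ! i) (xs ! j))"
    by (simp only: fib)
  finally show ?thesis .
qed

lemma noisy_gram_carrier [simp]: "noisy_gram k \<sigma> xs \<in> carrier_mat (length xs) (length xs)"
  by (simp add: noisy_gram_def gram_def)

lemma noisy_gram_index:
  "i < length xs \<Longrightarrow> j < length xs \<Longrightarrow>
    noisy_gram k \<sigma> xs $$ (i, j) = k (xs ! i) (xs ! j) + (if i = j then \<sigma>\<^sup>2 else 0)"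
  by (simp add: noisy_gram_def gram_def)

lemma mult_mat_vec_index_sum:
  assumes "A \<in> carrier_mat n m" "v \<in> carrier_vec m" "i < n"
  shows "(A *\<^sub>v v) $ i = (\<Sum>j<m. A $$ (i, j) * v $ j)"
  using assms by (auto simp: mult_mat_vec_def scalar_prod_def atLeast0LessThan intro!: sum.cong)

lemma noisy_gram_mult_vec:
  assumes "v \<in> carrier_vec (length xs)" "i < length xs"
  shows "(noisy_gram k \<sigma> xs *\<^sub>v v) $ i = (\<Sum>j<length xs. k (xs ! i) (xs ! j) * v $ j) + \<sigma>\<^sup>2 * v $ i"
  using assms
  by (simp add: mult_mat_vec_index_sum[OF noisy_gram_carrier] noisy_gram_index ring_distribs
      sum.distrib if_distrib[of "\<lambda>z. z * _"] cong: if_cong)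

text \<open>If the matrix annihilates \<open>v\<close>, then the kernel form at \<open>v\<close>
  plus \<open>\<sigma>\<^sup>2\<close> times the squared length of \<open>v\<close> is zero. Both
  terms are nonnegative, so the noise term forces \<open>v = 0\<close>, even when the Gram matrix
  itself is singular.\<close>

lemma noisy_gram_det_nz:
  fixes xs :: "'a list"
  assumes k: "pos_def_kernel D k" and xs: "set xs \<subseteq> D" and \<sigma>: "\<sigma> > 0"
  shows "Determinant.det (noisy_gram k \<sigma> xs) \<noteq> 0"
proof
  let ?n = "length xs"
  assume "Determinant.det (noisy_gram k \<sigma> xs) = 0"
  then obtain v where v: "v \<in> carrier_vec ?n" "v \<noteq> 0\<^sub>v ?n" "noisy_gram k \<sigma> xs *\<^sub>v v = 0\<^sub>v ?n"
    using det_0_iff_vec_prod_zero_field[OF noisy_gram_carrier] by blast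
  have *: "(\<Sum>j<?n. k (xs ! i) (xs ! j) * v $ j) + \<sigma>\<^sup>2 * v $ i = 0" if "i < ?n" for i
    using noisy_gram_mult_vec[OF v(1) that, of k \<sigma>] v(3) that by simp
  have "0 = (\<Sum>i<?n. v $ i * ((\<Sum>j<?n. k (xs ! i) (xs ! j) * v $ j) + \<sigma>\<^sup>2 * v $ i))"
    by (simp add: *)
  also have "\<dots> = (\<Sum>i<?n. \<Sum>j<?n. v $ i * v $ j * k (xs ! i) (xs ! j)) + \<sigma>\<^sup>2 * (\<Sum>i<?n. (v $ i)\<^sup>2)"
    by (simp add: ring_distribs sum.distrib sum_distrib_left power2_eq_square mult_ac)
  finally have "\<sigma>\<^sup>2 * (\<Sum>i<?n. (v $ i)\<^sup>2) \<le> 0"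
    using kernel_form_nonneg[OF k xs, of "\<lambda>i. v $ i"] by linarith
  then have "(\<Sum>i<?n. (v $ i)\<^sup>2) \<le> 0"
    using \<sigma> by (simp add: mult_le_0_iff zero_less_mult_iff)
  moreover have "(\<Sum>i<?n. (v $ i)\<^sup>2) \<ge> 0" by (simp add: sum_nonneg)
  ultimately have "\<forall>i\<in>{..<?n}. (v $ i)\<^sup>2 = 0"
    by (subst sum_nonneg_eq_0_iff[symmetric]) auto
  then have "v = 0\<^sub>v ?n"
    using v(1) by (intro eq_vecI) auto
  with v(2) show False by simp
qed

text \<open>The mean square error of predicting \<open>f x\<close> by the linear combination of the observations with
  weights \<open>w\<close>.\<close>

definition pred_risk :: "('a \<Rightarrow> 'a \<Rightarrow> real) \<Rightarrow> real \<Rightarrow> 'a list \<Rightarrow> 'a \<Rightarrow> (nat \<Rightarrow> real) \<Rightarrow> real" where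
  "pred_risk k \<sigma> xs x w = k x x - 2 * (\<Sum>i<length xs. w i * k (xs ! i) x)
     + (\<Sum>i<length xs. \<Sum>j<length xs. w i * w j * k (xs ! i) (xs ! j))
     + \<sigma>\<^sup>2 * (\<Sum>i<length xs. (w i)\<^sup>2)"

text \<open>The risk is quadratic in the weights. Completing the square around the weights
  \<open>z\<close>, which solve the noisy Gram system, leaves a nonnegative remainder that vanishes
  at \<open>z\<close>.\<close>

lemma post_var_pred_risk:
  fixes xs :: "'a list"
  assumes k: "pos_def_kernel D k" and xs: "set xs \<subseteq> D" and \<sigma>: "\<sigma> > 0"
  obtains w where "post_var k \<sigma> xs x = pred_risk k \<sigma> xs x w"
    and "\<And>w'. post_var k \<sigma> xs x \<le> pred_risk k \<sigma> xs x w'"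
proof -
  let ?n = "length xs" and ?A = "noisy_gram k \<sigma> xs" and ?K = "\<lambda>i j. k (xs ! i) (xs ! j)"
  have det: "Determinant.det ?A \<noteq> 0" by (rule noisy_gram_det_nz[OF k xs \<sigma>])
  define z where "z = minv ?A *\<^sub>v kvec k xs x"
  have kv: "kvec k xs x \<in> carrier_vec ?n" by (simp add: kvec_def)
  have z: "z \<in> carrier_vec ?n"
    using minv_eq_adj(1)[OF noisy_gram_carrier det] kv by (simp add: z_def)
  have "?A *\<^sub>v z = kvec k xs x"
    using minv_eq_adj(1,2)[OF noisy_gram_carrier det] kv
    by (simp add: z_def flip: assoc_mult_mat_vec[of _ ?n ?n _ ?n])
  \<comment> \<open>These normal equations express each \<open>k (xs ! i) x\<close> through
    \<open>z\<close>, so that only kernel values between data points remain in the difference of the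
    risks.\<close>
  then have Az: "k (xs ! i) x = (\<Sum>j<?n. ?K i j * z $ j) + \<sigma>\<^sup>2 * z $ i" if "i < ?n" for i
    using noisy_gram_mult_vec[OF z that, of k \<sigma>] that by (simp add: kvec_def)
  have "post_var k \<sigma> xs x = k x x - scalar_prod (kvec k xs x) z"
    by (simp only: post_var_def post_cov_def z_def)
  then have pv: "post_var k \<sigma> xs x = k x x - (\<Sum>i<?n. k (xs ! i) x * z $ i)"
    using z by (simp add: scalar_prod_def kvec_def atLeast0LessThan)
  have sym: "?K i j = ?K j i" if "i < ?n" "j < ?n" for i j
    using kernel_sym[OF k] xs that by (meson nth_mem subsetD)
  have cross: "(\<Sum>i<?n. w i * k (xs ! i) x) =
      (\<Sum>i<?n. \<Sum>j<?n. w i * z $ j * ?K i j) + \<sigma>\<^sup>2 * (\<Sum>i<?n. w i * z $ i)" for w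
  proof -
    have "(\<Sum>i<?n. w i * k (xs ! i) x) =
        (\<Sum>i<?n. w i * ((\<Sum>j<?n. ?K i j * z $ j) + \<sigma>\<^sup>2 * z $ i))"
      by (intro sum.cong refl) (simp only: Az lessThan_iff)
    then show ?thesis
      by (simp add: ring_distribs sum.distrib sum_distrib_left mult_ac)
  qed
  \<comment> \<open>Symmetry of the kernel identifies the two mixed sums that arise when
    \<open>(w i - z $ i) * (w j - z $ j)\<close> is expanded.\<close>
  have swap: "(\<Sum>i<?n. \<Sum>j<?n. z $ i * w j * ?K i j) = (\<Sum>i<?n. \<Sum>j<?n. w i * z $ j * ?K i j)" for w
    by (subst sum.swap, intro sum.cong refl) (use sym in auto)
  have diff: "pred_risk k \<sigma> xs x w - post_var k \<sigma> xs x =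
      (\<Sum>i<?n. \<Sum>j<?n. (w i - z $ i) * (w j - z $ j) * ?K i j) + \<sigma>\<^sup>2 * (\<Sum>i<?n. (w i - z $ i)\<^sup>2)"
    for w
  proof -
    have 1: "(\<Sum>i<?n. \<Sum>j<?n. (w i - z $ i) * (w j - z $ j) * ?K i j) =
      (\<Sum>i<?n. \<Sum>j<?n. w i * w j * ?K i j) - 2 * (\<Sum>i<?n. \<Sum>j<?n. w i * z $ j * ?K i j)
      + (\<Sum>i<?n. \<Sum>j<?n. z $ i * z $ j * ?K i j)"
      using swap[of w] by (simp add: ring_distribs sum.distrib sum_subtractf)
    have 2: "(\<Sum>i<?n. (w i - z $ i)\<^sup>2) =
      (\<Sum>i<?n. (w i)\<^sup>2) - 2 * (\<Sum>i<?n. w i * z $ i) + (\<Sum>i<?n. (z $ i)\<^sup>2)"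
      by (simp add: power2_diff sum.distrib sum_subtractf sum_distrib_left mult_ac)
    have 3: "(\<Sum>i<?n. k (xs ! i) x * z $ i) = (\<Sum>i<?n. \<Sum>j<?n. z $ i * z $ j * ?K i j)
      + \<sigma>\<^sup>2 * (\<Sum>i<?n. (z $ i)\<^sup>2)"
      using cross[of "\<lambda>i. z $ i"] by (simp add: mult.commute power2_eq_square)
    show ?thesis
      unfolding pred_risk_def pv 1 2 3 cross by (simp add: algebra_simps)
  qed
  show thesis
  proof
    show "post_var k \<sigma> xs x = pred_risk k \<sigma> xs x (\<lambda>i. z $ i)"
      using diff[of "\<lambda>i. z $ i"] by simp
    show "post_var k \<sigma> xs x \<le> pred_risk k \<sigma> xs x w" for w
    proof -
      have "0 \<le> \<sigma>\<^sup>2 * (\<Sum>i<?n. (w i - z $ i)\<^sup>2)"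
        by (intro mult_nonneg_nonneg sum_nonneg) auto
      then show ?thesis
        using diff[of w] kernel_form_nonneg[OF k xs, of "\<lambda>i. w i - z $ i"] by linarith
    qed
  qed
qed

text \<open>Extending the optimal weights by zero turns a predictor using fewer points into one using
  more points with the same risk.\<close>

lemma post_var_mono:
  fixes xs :: "'a list"
  assumes k: "pos_def_kernel D k" and xs: "set xs \<subseteq> D" and \<sigma>: "\<sigma> > 0"
    and \<phi>: "inj_on \<phi> {..<m}" "\<phi> ` {..<m} \<subseteq> {..<length xs}"
  shows "post_var k \<sigma> xs x \<le> post_var k \<sigma> (map (\<lambda>i. xs ! \<phi> i) [0..<m]) x"
proof -
  let ?ys = "map (\<lambda>i. xs ! \<phi> i) [0..<m]"
  have ys: "set ?ys \<subseteq> D"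
    using xs \<phi>(2) by (auto simp: image_subset_iff)
  obtain w where w: "post_var k \<sigma> ?ys x = pred_risk k \<sigma> ?ys x w"
    using post_var_pred_risk[OF k ys \<sigma>] by metis
  define w' where "w' i = (if i \<in> \<phi> ` {..<m} then w (the_inv_into {..<m} \<phi> i) else 0)" for i
  have w': "w' (\<phi> i) = w i" if "i < m" for i
    using that \<phi>(1) by (simp add: w'_def the_inv_into_f_f)
  have reindex: "(\<Sum>i<length xs. g i) = (\<Sum>i<m. g (\<phi> i))"
    if "\<And>i. i \<notin> \<phi> ` {..<m} \<Longrightarrow> g i = 0" for g :: "nat \<Rightarrow> real"
  proof -
    have "(\<Sum>i<length xs. g i) = (\<Sum>i\<in>\<phi> ` {..<m}. g i)"
      using \<phi>(2) that by (intro sum.mono_neutral_right) auto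
    also have "\<dots> = (\<Sum>i<m. g (\<phi> i))"
      using \<phi>(1) by (simp add: sum.reindex)
    finally show ?thesis .
  qed
  have z: "w' i = 0" if "i \<notin> \<phi> ` {..<m}" for i
    using that by (simp add: w'_def)
  have "(\<Sum>i<length xs. w' i * k (xs ! i) x) = (\<Sum>i<length ?ys. w i * k (?ys ! i) x)"
    by (subst reindex) (auto simp: z w' intro!: sum.cong)
  moreover have "(\<Sum>i<length xs. \<Sum>j<length xs. w' i * w' j * k (xs ! i) (xs ! j)) =
      (\<Sum>i<length ?ys. \<Sum>j<length ?ys. w i * w j * k (?ys ! i) (?ys ! j))"
  proof -
    have "(\<Sum>i<length xs. \<Sum>j<length xs. w' i * w' j * k (xs ! i) (xs ! j)) =
       (\<Sum>i<length xs. \<Sum>j<m. w' i * w' (\<phi> j) * k (xs ! i) (xs ! \<phi> j))"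
      by (rule sum.cong[OF refl], subst reindex) (auto simp: z)
    also have "\<dots> = (\<Sum>i<m. \<Sum>j<m. w' (\<phi> i) * w' (\<phi> j) * k (xs ! \<phi> i) (xs ! \<phi> j))"
      by (subst reindex) (auto simp: z)
    finally show ?thesis
      by (simp add: w')
  qed
  moreover have "(\<Sum>i<length xs. (w' i)\<^sup>2) = (\<Sum>i<length ?ys. (w i)\<^sup>2)"
    by (subst reindex) (auto simp: z w')
  ultimately have "pred_risk k \<sigma> xs x w' = pred_risk k \<sigma> ?ys x w"
    by (simp only: pred_risk_def)
  moreover have "post_var k \<sigma> xs x \<le> pred_risk k \<sigma> xs x w'"
    using post_var_pred_risk[OF k xs \<sigma>] by metis
  ultimately show ?thesis using w by simp
qed

section \<open>Repeated evaluations and the classification threshold\<close>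

lemma repeated_var_eq: "repeated_var k \<sigma> t x = post_var k \<sigma> (replicate t x) x"
proof -
  have "k x x \<cdot>\<^sub>m Matrix.mat t t (\<lambda>_. 1) = gram k (replicate t x)"
    by (rule eq_matI) (auto simp: gram_def)
  moreover have "k x x \<cdot>\<^sub>v Matrix.vec t (\<lambda>_. 1) = kvec k (replicate t x) x"
    by (rule eq_vecI) (auto simp: kvec_def)
  ultimately show ?thesis
    by (simp add: repeated_var_def post_var_def post_cov_def noisy_gram_def Let_def)
qed

text \<open>The plain average, with all weights \<open>1 / real t\<close>, competes in the
  minimisation. All \<open>t\<close> points coincide with \<open>x\<close>, so the kernel terms of
  its risk cancel as \<open>k x x - 2 * k x x + k x x\<close>, and only the averaged noise
  remains.\<close>

lemma repeated_var_le:
  assumes k: "pos_def_kernel D k" and x: "x \<in> D" and \<sigma>: "\<sigma> > 0" and t: "t > 0"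
  shows "repeated_var k \<sigma> t x \<le> \<sigma>\<^sup>2 / real t"
proof -
  have "set (replicate t x) \<subseteq> D" using x by auto
  then have "repeated_var k \<sigma> t x \<le> pred_risk k \<sigma> (replicate t x) x (\<lambda>_. 1 / real t)"
    unfolding repeated_var_eq using post_var_pred_risk[OF k _ \<sigma>] by metis
  also have "\<dots> = \<sigma>\<^sup>2 / real t"
    using t by (simp add: pred_risk_def power2_eq_square field_simps)
  finally show ?thesis .
qed

text \<open>The half-width of the confidence interval is below \<open>\<epsilon>\<close>. If the
  posterior mean is at least \<open>h\<close>, the lower bound exceeds
  \<open>h - \<epsilon>\<close>; otherwise the upper bound is below
  \<open>h + \<epsilon>\<close>.\<close>

lemma HL_set_if_post_var_less:
  assumes x: "x \<in> \<Omega>" and \<epsilon>: "\<epsilon> > 0" and \<beta>: "\<beta> > 0"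
    and v: "post_var k \<sigma> (map fst d) x < \<epsilon>\<^sup>2 / \<beta>"
  shows "x \<in> HL_set k \<sigma> \<beta> h \<epsilon> \<Omega> d"
proof -
  have "sqrt \<beta> * post_sd k \<sigma> d x = sqrt (\<beta> * post_var k \<sigma> (map fst d) x)"
    by (simp add: post_sd_def real_sqrt_mult)
  also have "\<dots> < sqrt (\<epsilon>\<^sup>2)"
    by (subst real_sqrt_less_iff) (use v \<beta> in \<open>simp add: field_simps\<close>)
  finally have "sqrt \<beta> * post_sd k \<sigma> d x < \<epsilon>"
    using \<epsilon> by simp
  then show ?thesis
    using x by (auto simp: HL_set_def H_set_def L_set_def lower_bd_def upper_bd_def)
qed

section \<open>Measurability of the posterior\<close>

text \<open>The Leibniz expansion is a polynomial in the entries.\<close>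

lemma borel_measurable_det:
  fixes B :: "'w \<Rightarrow> real mat"
  assumes B: "\<And>\<omega>. \<omega> \<in> space A \<Longrightarrow> B \<omega> \<in> carrier_mat n n"
    and entries: "\<And>i j. i < n \<Longrightarrow> j < n \<Longrightarrow> (\<lambda>\<omega>. B \<omega> $$ (i, j)) \<in> borel_measurable A"
  shows "(\<lambda>\<omega>. Determinant.det (B \<omega>)) \<in> borel_measurable A"
proof -
  have "(\<lambda>\<omega>. \<Sum>\<pi> | \<pi> permutes {0..<n}. signof \<pi> * (\<Prod>i=0..<n. B \<omega> $$ (i, \<pi> i)))
      \<in> borel_measurable A"
    by (intro borel_measurable_sum borel_measurable_times borel_measurable_const
        borel_measurable_prod entries) (auto simp: permutes_in_image[where S="{0..<n}", simplified])
  then show ?thesis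
    by (subst measurable_cong[OF det_def'[OF B]]) auto
qed

lemma borel_measurable_minv:
  fixes B :: "'w \<Rightarrow> real mat"
  assumes B: "\<And>\<omega>. \<omega> \<in> space A \<Longrightarrow> B \<omega> \<in> carrier_mat n n"
    and det: "\<And>\<omega>. \<omega> \<in> space A \<Longrightarrow> Determinant.det (B \<omega>) \<noteq> 0"
    and entries: "\<And>i j. i < n \<Longrightarrow> j < n \<Longrightarrow> (\<lambda>\<omega>. B \<omega> $$ (i, j)) \<in> borel_measurable A"
    and ij: "i < n" "j < n"
  shows "(\<lambda>\<omega>. minv (B \<omega>) $$ (i, j)) \<in> borel_measurable A"
proof -
  \<comment> \<open>The adjugate is the transposed cofactor matrix, so entry \<open>(i, j)\<close>
    of the inverse needs the minor without row \<open>j\<close> and column \<open>i\<close>.\<close>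
  have minor: "(\<lambda>\<omega>. Determinant.det (mat_delete (B \<omega>) j i)) \<in> borel_measurable A"
  proof (rule borel_measurable_det)
    show "mat_delete (B \<omega>) j i \<in> carrier_mat (n - 1) (n - 1)" if "\<omega> \<in> space A" for \<omega>
      using B[OF that] by (rule mat_delete_carrier)
    fix i' j' assume "i' < n - 1" "j' < n - 1"
    moreover have "dim_row (B \<omega>) = n" "dim_col (B \<omega>) = n" if "\<omega> \<in> space A" for \<omega>
      using B[OF that] by auto
    ultimately show "(\<lambda>\<omega>. mat_delete (B \<omega>) j i $$ (i', j')) \<in> borel_measurable A"
      by (subst measurable_cong[where g="\<lambda>\<omega>. B \<omega> $$ (if i' < j then i' else Suc i', if j' < i then j' else Suc j')"])
        (auto simp: mat_delete_def intro!: entries)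
  qed
  have "minv (B \<omega>) $$ (i, j) =
      inverse (Determinant.det (B \<omega>)) * ((-1) ^ (j + i) * Determinant.det (mat_delete (B \<omega>) j i))"
    if "\<omega> \<in> space A" for \<omega>
    using minv_eq_adj(3)[OF B det] B[OF that] that ij by (simp add: adj_mat_def cofactor_def)
  then show ?thesis
    by (subst measurable_cong, assumption)
      (intro borel_measurable_times borel_measurable_inverse borel_measurable_const minor
        borel_measurable_det[OF B entries])
qed

lemma (in lse_setting) borel_measurable_kernel:
  assumes "X \<in> measurable A (restrict_space borel D)" "Y \<in> measurable A (restrict_space borel D)"
  shows "(\<lambda>\<omega>. k (X \<omega>) (Y \<omega>)) \<in> borel_measurable A"
  using measurable_compose[OF measurable_Pair[OF assms] kernel_measurable] by simp

text \<open>The vector \<open>v\<close> is kept general because the result serves twice: with the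
  observations it gives the posterior mean, with the kernel vector at \<open>x\<close> the variance
  reduction.\<close>

lemma (in lse_setting) borel_measurable_quadratic:
  fixes xs :: "'w \<Rightarrow> 'a list" and X :: "nat \<Rightarrow> 'w \<Rightarrow> 'a"
  assumes X: "\<And>i. i < n \<Longrightarrow> X i \<in> measurable A (restrict_space borel D)"
    and xs: "\<And>\<omega>. xs \<omega> = map (\<lambda>i. X i \<omega>) [0..<n]"
    and x: "x \<in> D"
    and v: "\<And>\<omega>. v \<omega> \<in> carrier_vec n" "\<And>i. i < n \<Longrightarrow> (\<lambda>\<omega>. v \<omega> $ i) \<in> borel_measurable A"
  shows "(\<lambda>\<omega>. scalar_prod (kvec k (xs \<omega>) x) (minv (noisy_gram k \<sigma> (xs \<omega>)) *\<^sub>v v \<omega>))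
    \<in> borel_measurable A"
proof -
  have len: "length (xs \<omega>) = n" for \<omega> by (simp add: xs)
  have sub: "set (xs \<omega>) \<subseteq> D" if "\<omega> \<in> space A" for \<omega>
    using that measurable_space[OF X] by (force simp: xs space_restrict_space)
  have det: "Determinant.det (noisy_gram k \<sigma> (xs \<omega>)) \<noteq> 0" if "\<omega> \<in> space A" for \<omega>
    by (rule noisy_gram_det_nz[OF kernel sub[OF that] noise_sd])
  have car: "noisy_gram k \<sigma> (xs \<omega>) \<in> carrier_mat n n" for \<omega>
    using noisy_gram_carrier[of k \<sigma> "xs \<omega>"] by (simp add: len)
  have inv: "(\<lambda>\<omega>. minv (noisy_gram k \<sigma> (xs \<omega>)) $$ (i, j)) \<in> borel_measurable A"
    if "i < n" "j < n" for i j
  proof (rule borel_measurable_minv[OF car det _ that])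
    fix i j assume ij: "i < n" "j < n"
    then have "noisy_gram k \<sigma> (xs \<omega>) $$ (i, j) = k (X i \<omega>) (X j \<omega>) + (if i = j then \<sigma>\<^sup>2 else 0)" for \<omega>
      by (simp add: noisy_gram_index len) (simp add: xs)
    then show "(\<lambda>\<omega>. noisy_gram k \<sigma> (xs \<omega>) $$ (i, j)) \<in> borel_measurable A"
      using borel_measurable_kernel[OF X X, OF ij] by simp
  qed
  have const: "(\<lambda>_. x) \<in> measurable A (restrict_space borel D)"
    using x by (intro measurable_restrict_space2) auto
  have "(\<lambda>\<omega>. \<Sum>i<n. k (X i \<omega>) x * (\<Sum>j<n. minv (noisy_gram k \<sigma> (xs \<omega>)) $$ (i, j) * v \<omega> $ j))
      \<in> borel_measurable A"
    by (intro borel_measurable_sum borel_measurable_times inv v borel_measurable_kernel X const) auto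
  moreover have "scalar_prod (kvec k (xs \<omega>) x) (minv (noisy_gram k \<sigma> (xs \<omega>)) *\<^sub>v v \<omega>) =
      (\<Sum>i<n. k (X i \<omega>) x * (\<Sum>j<n. minv (noisy_gram k \<sigma> (xs \<omega>)) $$ (i, j) * v \<omega> $ j))"
    if "\<omega> \<in> space A" for \<omega>
  proof -
    have m: "minv (noisy_gram k \<sigma> (xs \<omega>)) \<in> carrier_mat n n"
      by (rule minv_eq_adj(1)[OF car det[OF that]])
    then have "scalar_prod (kvec k (xs \<omega>) x) (minv (noisy_gram k \<sigma> (xs \<omega>)) *\<^sub>v v \<omega>) =
        (\<Sum>i<n. kvec k (xs \<omega>) x $ i * (minv (noisy_gram k \<sigma> (xs \<omega>)) *\<^sub>v v \<omega>) $ i)"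
      unfolding scalar_prod_def atLeast0LessThan by simp
    also have "\<dots> = (\<Sum>i<n. k (X i \<omega>) x * (\<Sum>j<n. minv (noisy_gram k \<sigma> (xs \<omega>)) $$ (i, j) * v \<omega> $ j))"
    proof (rule sum.cong[OF refl])
      fix i assume "i \<in> {..<n}"
      then have i: "i < n" by simp
      then have "kvec k (xs \<omega>) x $ i = k (X i \<omega>) x"
        by (simp add: kvec_def xs)
      then show "kvec k (xs \<omega>) x $ i * (minv (noisy_gram k \<sigma> (xs \<omega>)) *\<^sub>v v \<omega>) $ i =
          k (X i \<omega>) x * (\<Sum>j<n. minv (noisy_gram k \<sigma> (xs \<omega>)) $$ (i, j) * v \<omega> $ j)"
        by (simp only: mult_mat_vec_index_sum[OF m v(1) i])
    qed
    finally show ?thesis .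
  qed
  ultimately show ?thesis
    by (subst measurable_cong) auto
qed

lemma (in lse_setting) borel_measurable_post:
  fixes X :: "nat \<Rightarrow> 'w \<Rightarrow> 'a" and Y :: "nat \<Rightarrow> 'w \<Rightarrow> real"
  assumes X: "\<And>i. i < n \<Longrightarrow> X i \<in> measurable A (restrict_space borel D)"
    and Y: "\<And>i. i < n \<Longrightarrow> Y i \<in> borel_measurable A"
    and d: "\<And>\<omega>. \<omega> \<in> space A \<Longrightarrow> d \<omega> = map (\<lambda>i. (X i \<omega>, Y i \<omega>)) [0..<n]"
    and x: "x \<in> D"
  shows borel_measurable_post_mean: "(\<lambda>\<omega>. post_mean k \<sigma> (d \<omega>) x) \<in> borel_measurable A"
    and borel_measurable_post_sd: "(\<lambda>\<omega>. post_sd k \<sigma> (d \<omega>) x) \<in> borel_measurable A"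
proof -
  define xs where "xs \<omega> = map (\<lambda>i. X i \<omega>) [0..<n]" for \<omega>
  define ys where "ys \<omega> = vec_of_list (map (\<lambda>i. Y i \<omega>) [0..<n])" for \<omega>
  have fst: "map fst (d \<omega>) = xs \<omega>" and snd: "vec_of_list (map snd (d \<omega>)) = ys \<omega>"
    if "\<omega> \<in> space A" for \<omega>
    using d[OF that] by (simp_all add: xs_def ys_def comp_def)
  have "(\<lambda>\<omega>. ys \<omega> $ i) \<in> borel_measurable A" if "i < n" for i
    using Y[OF that] that by (simp add: ys_def vec_of_list_index)
  moreover have "ys \<omega> \<in> carrier_vec n" for \<omega>
    unfolding ys_def by (rule carrier_vecI) simp
  ultimately have "(\<lambda>\<omega>. scalar_prod (kvec k (xs \<omega>) x) (minv (noisy_gram k \<sigma> (xs \<omega>)) *\<^sub>v ys \<omega>))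
      \<in> borel_measurable A"
    using X xs_def x by (intro borel_measurable_quadratic[where X=X and n=n and xs=xs and v=ys])
  moreover have "post_mean k \<sigma> (d \<omega>) x =
      scalar_prod (kvec k (xs \<omega>) x) (minv (noisy_gram k \<sigma> (xs \<omega>)) *\<^sub>v ys \<omega>)" if "\<omega> \<in> space A" for \<omega>
    by (simp only: post_mean_def fst[OF that] snd[OF that])
  ultimately show "(\<lambda>\<omega>. post_mean k \<sigma> (d \<omega>) x) \<in> borel_measurable A"
    by (simp cong: measurable_cong)
  have const: "(\<lambda>_. x) \<in> measurable A (restrict_space borel D)"
    using x by (intro measurable_restrict_space2) auto
  have "(\<lambda>\<omega>. kvec k (xs \<omega>) x $ i) \<in> borel_measurable A" if "i < n" for i
    using borel_measurable_kernel[OF X[OF that] const] that by (simp add: kvec_def xs_def)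
  moreover have "kvec k (xs \<omega>) x \<in> carrier_vec n" for \<omega>
    unfolding kvec_def xs_def by (rule carrier_vecI) simp
  ultimately have "(\<lambda>\<omega>. scalar_prod (kvec k (xs \<omega>) x) (minv (noisy_gram k \<sigma> (xs \<omega>)) *\<^sub>v kvec k (xs \<omega>) x))
      \<in> borel_measurable A"
    using X xs_def x by (intro borel_measurable_quadratic[where X=X and n=n and xs=xs
          and v="\<lambda>\<omega>. kvec k (xs \<omega>) x"])
  then have "(\<lambda>\<omega>. sqrt (k x x - scalar_prod (kvec k (xs \<omega>) x) (minv (noisy_gram k \<sigma> (xs \<omega>)) *\<^sub>v kvec k (xs \<omega>) x)))
      \<in> borel_measurable A"
    by (intro measurable_compose[OF _ borel_measurable_sqrt] borel_measurable_diff borel_measurable_const)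
  moreover have "post_sd k \<sigma> (d \<omega>) x =
      sqrt (k x x - scalar_prod (kvec k (xs \<omega>) x) (minv (noisy_gram k \<sigma> (xs \<omega>)) *\<^sub>v kvec k (xs \<omega>) x))"
    if "\<omega> \<in> space A" for \<omega>
    by (simp only: post_sd_def post_var_def post_cov_def fst[OF that])
  ultimately show "(\<lambda>\<omega>. post_sd k \<sigma> (d \<omega>) x) \<in> borel_measurable A"
    by (simp cong: measurable_cong)
qed

section \<open>Hitting probabilities along a run\<close>

declare [[simproc del: measurable]]

context lse_run
begin

section \<open>Information and data along a run\<close>

lemma space_F [simp]: "space (F t) = space M"
  using F_sub by (simp add: subalgebra_def)

lemma sets_F_mono: "i \<le> j \<Longrightarrow> sets (F i) \<subseteq> sets (F j)"
proof (induction j rule: dec_induct)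
  case (step j)
  have "sets (F j) \<subseteq> sets (F (Suc j))"
    using G_past[of "Suc j"] F_step[of "Suc j"] by (auto simp: subalgebra_def)
  with step.IH show ?case by blast
qed simp

lemma subalgebra_F_mono: "i \<le> j \<Longrightarrow> subalgebra (F j) (F i)"
  using sets_F_mono by (simp add: subalgebra_def)

lemma subalgebra_F_E: "i \<le> n0 \<Longrightarrow> subalgebra (F t) (E i)"
proof (induction i rule: inc_induct)
  case base
  show ?case using F_0 sets_F_mono[of 0 t] by (auto simp: subalgebra_def)
next
  case (step i)
  then show ?case using E_mono[of i] by (auto simp: subalgebra_def)
qed

text \<open>Initial data and trials share one enumeration. Trial \<open>t\<close> has position
  \<open>n0 + t - 1\<close>, because trials are counted from 1 and list positions from 0.\<close>

definition pt :: "nat \<Rightarrow> 'w \<Rightarrow> 'a" where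
  "pt i = (if i < n0 then s0 i else s (i - n0 + 1))"

definition obs :: "nat \<Rightarrow> 'w \<Rightarrow> real" where
  "obs i \<omega> = f \<omega> (pt i \<omega>) + (if i < n0 then e0 i \<omega> else e (i - n0 + 1) \<omega>)"

lemma dat_eq: "\<omega> \<in> space M \<Longrightarrow> dat t \<omega> = map (\<lambda>i. (pt i \<omega>, obs i \<omega>)) [0..<n0 + t]"
proof (induction t)
  case 0
  then show ?case by (auto simp: dat_0 pt_def obs_def)
next
  case (Suc t)
  then show ?case using dat_step[of "Suc t" \<omega>] by (simp add: pt_def obs_def)
qed

lemma pt_measurable: "i < n0 + t \<Longrightarrow> pt i \<in> measurable (F t) (restrict_space borel D)"
  using measurable_from_subalg[OF subalgebra_F_E s0_measurable, of i t]
    measurable_from_subalg[OF subalgebra_F_mono s_measurable, of "i - n0 + 1" t]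
  by (cases "i < n0") (simp_all add: pt_def)

lemma obs_measurable:
  assumes "i < n0 + t"
  shows "obs i \<in> borel_measurable (F t)"
proof -
  \<comment> \<open>The black box is itself random, so its value at a random point comes from
    composing the jointly measurable map with the pairing of \<open>\<omega>\<close> and
    \<open>pt i \<omega>\<close>; the identity is measurable into the coarser
    \<open>E 0\<close>.\<close>
  have "(\<lambda>\<omega>. \<omega>) \<in> measurable (F t) (E 0)"
    by (rule measurable_from_subalg[OF subalgebra_F_E measurable_ident_sets[OF refl]]) simp
  from measurable_compose[OF measurable_Pair[OF this pt_measurable[OF assms]] f_measurable]
  have "(\<lambda>\<omega>. f \<omega> (pt i \<omega>)) \<in> borel_measurable (F t)" by simp
  moreover have "(\<lambda>\<omega>. if i < n0 then e0 i \<omega> else e (i - n0 + 1) \<omega>) \<in> borel_measurable (F t)"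
    using measurable_from_subalg[OF subalgebra_F_E e0_measurable, of i t]
      measurable_from_subalg[OF subalgebra_F_mono e_measurable, of "i - n0 + 1" t] assms
    by (cases "i < n0") auto
  ultimately show ?thesis
    unfolding obs_def by (rule borel_measurable_add)
qed

abbreviation unclassified :: "'w \<Rightarrow> nat \<Rightarrow> 'a set" where
  "unclassified \<omega> \<equiv> U_set k \<sigma> \<beta> h \<epsilon> \<Omega> (\<lambda>j. dat j \<omega>)"

abbreviation running :: "'w \<Rightarrow> nat \<Rightarrow> bool" where
  "running \<omega> \<equiv> performed k \<sigma> \<beta> h \<epsilon> \<Omega> (\<lambda>j. dat j \<omega>)"

text \<open>For \<open>t > 0\<close> the event is a finite union over candidates of pairs of
  inequalities between posterior quantities; at \<open>t = 0\<close> it is the whole space, because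
  all of the nonempty \<open>\<Omega>\<close> counts as unclassified.\<close>

lemma sets_unclassified: "{\<omega> \<in> space M. unclassified \<omega> t \<noteq> {}} \<in> sets (F t)"
proof (cases "t = 0")
  case True
  then show ?thesis
    using cand(3) sets.top[of "F 0"] by (simp add: U_set_def)
next
  case False
  have [measurable]: "(\<lambda>\<omega>. post_mean k \<sigma> (dat t \<omega>) x) \<in> borel_measurable (F t)"
      "(\<lambda>\<omega>. post_sd k \<sigma> (dat t \<omega>) x) \<in> borel_measurable (F t)" if "x \<in> \<Omega>" for x
    using borel_measurable_post[where A="F t" and n="n0 + t" and X=pt and Y=obs and d="dat t"]
      pt_measurable obs_measurable dat_eq that cand(1) by auto
  have "{\<omega> \<in> space (F t). \<exists>x\<in>\<Omega>. lower_bd k \<sigma> \<beta> (dat t \<omega>) x \<le> h - \<epsilon>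
      \<and> h + \<epsilon> \<le> upper_bd k \<sigma> \<beta> (dat t \<omega>) x} \<in> sets (F t)"
    unfolding lower_bd_def upper_bd_def using cand(2) by measurable
  also have "{\<omega> \<in> space (F t). \<exists>x\<in>\<Omega>. lower_bd k \<sigma> \<beta> (dat t \<omega>) x \<le> h - \<epsilon>
      \<and> h + \<epsilon> \<le> upper_bd k \<sigma> \<beta> (dat t \<omega>) x} = {\<omega> \<in> space M. unclassified \<omega> t \<noteq> {}}"
    using False by (auto simp: U_set_def HL_set_def H_set_def L_set_def not_less)
  finally show ?thesis .
qed

text \<open>\<open>performed\<close> inspects the unclassified sets only up to index
  \<open>t - 1\<close>. With this earlier index in the conclusion, the event can be joined to a past
  event in the conditional laws.\<close>

lemma sets_running: "t \<ge> 1 \<Longrightarrow> {\<omega> \<in> space M. running \<omega> t} \<in> sets (F (t - 1))"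
proof -
  assume t: "t \<ge> 1"
  have "{\<omega> \<in> space (F (t - 1)). \<forall>j\<in>{..<t}. unclassified \<omega> j \<noteq> {}} \<in> sets (F (t - 1))"
  proof (intro sets.sets_Collect_finite_All)
    fix j assume "j \<in> {..<t}"
    then have "j \<le> t - 1" by auto
    then show "{\<omega> \<in> space (F (t - 1)). unclassified \<omega> j \<noteq> {}} \<in> sets (F (t - 1))"
      using sets_unclassified[of j] sets_F_mono by auto
  qed simp
  then show ?thesis
    unfolding performed_def space_F Ball_def lessThan_iff .
qed

section \<open>Hitting and missing a set\<close>

lemma s_borel: "t \<ge> 1 \<Longrightarrow> s t \<in> borel_measurable (F t)"
  and s_in_D: "t \<ge> 1 \<Longrightarrow> \<omega> \<in> space M \<Longrightarrow> s t \<omega> \<in> D"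
  using s_measurable[of t] by (auto simp: measurable_restrict_space2_iff)

lemma sets_F_in_M: "A \<in> sets (F t) \<Longrightarrow> A \<in> sets M"
  using F_sub[of t] by (auto simp: subalgebra_def)

text \<open>Only random requests are counted; those maximising the acquisition function are bounded
  below by zero. Splitting by the drawn pair gives disjoint events \<open>Ev q\<close> inside the
  hitting event, and each factors by \<open>draw_law\<close> and \<open>sample_law\<close>.\<close>

lemma prob_hit_ge:
  assumes t: "t \<ge> 1" and A: "A \<in> sets (F (t - 1))" and run: "\<And>\<omega>. \<omega> \<in> A \<Longrightarrow> running \<omega> t"
    and B: "B \<in> sets borel"
  shows "p t * (\<Sum>a\<in>\<Omega>. \<Sum>i=1..K. \<kappa> i * measure N {v \<in> space N. S a (c i) v \<in> B}) * measure M A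
    \<le> measure M {\<omega> \<in> A. s t \<omega> \<in> B}"
proof -
  let ?P = "\<lambda>(a, i). measure N {v \<in> space N. S a (c i) v \<in> B}"
  define Ev where "Ev q = {\<omega> \<in> A. (r t \<omega> = True \<and> C t \<omega> = q) \<and> s t \<omega> \<in> B}" for q
  have spG: "space (G t) = space M"
    using F_step[OF t] by (simp add: subalgebra_def)
  have A_sp: "A \<subseteq> space M"
    using sets.sets_into_space[OF A] by simp
  have A_G: "A \<in> sets (G t)"
    using G_past[OF t] A by (auto simp: subalgebra_def)
  have sG: "{\<omega> \<in> A. r t \<omega> = True \<and> C t \<omega> = q} \<in> sets (G t)" if "q \<in> \<Omega> \<times> {1..K}" for q
  proof -
    have "r t -` {True} \<inter> space (G t) \<in> sets (G t)" "C t -` {q} \<inter> space (G t) \<in> sets (G t)"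
      using that by (auto intro!: measurable_sets[OF r_measurable[OF t]] measurable_sets[OF C_measurable[OF t]])
    then have "A \<inter> (r t -` {True} \<inter> space (G t)) \<inter> (C t -` {q} \<inter> space (G t)) \<in> sets (G t)"
      using A_G by (blast intro: sets.Int)
    also have "A \<inter> (r t -` {True} \<inter> space (G t)) \<inter> (C t -` {q} \<inter> space (G t)) =
        {\<omega> \<in> A. r t \<omega> = True \<and> C t \<omega> = q}"
      using A_sp by (auto simp: spG)
    finally show ?thesis .
  qed
  have GF: "sets (G t) \<subseteq> sets (F t)"
    using F_step[OF t] by (simp add: subalgebra_def)
  have s_B: "s t -` B \<inter> space M \<in> sets M"
    using measurable_sets[OF s_borel[OF t] B] sets_F_in_M by simp
  have hit_M: "{\<omega> \<in> A'. s t \<omega> \<in> B} \<in> sets M" if "A' \<in> sets (G t)" for A'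
  proof -
    have A': "A' \<in> sets M" using that GF sets_F_in_M by blast
    then have "{\<omega> \<in> A'. s t \<omega> \<in> B} = A' \<inter> (s t -` B \<inter> space M)"
      using sets.sets_into_space by blast
    then show ?thesis using A' s_B by (simp add: sets.Int)
  qed
  have Ev_M: "Ev q \<in> sets M" if "q \<in> \<Omega> \<times> {1..K}" for q
    using hit_M[OF sG[OF that]] by (simp add: Ev_def)
  have normal: "measure (normal_measure 0 \<sigma>) UNIV = 1"
    using prob_space.prob_space[OF prob_space_normal_density[OF noise_sd, of 0]] by simp
  have Ev_prob: "measure M (Ev q) = p t * measure M A * (\<kappa> (snd q) * ?P q)" if "q \<in> \<Omega> \<times> {1..K}" for q
  proof -
    obtain a i where q: "q = (a, i)" "a \<in> \<Omega>" "i \<in> {1..K}" using \<open>q \<in> \<Omega> \<times> {1..K}\<close> by auto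
    let ?A = "{\<omega> \<in> A. r t \<omega> = True \<and> C t \<omega> = (a, i)}"
    \<comment> \<open>The trial is performed and random, so the drawn pair is the actual request.
      Taking \<open>UNIV\<close> for the noise then makes the last factor of
      \<open>sample_law\<close> equal to one.\<close>
    have req: "req t \<omega> = (a, i)" if "\<omega> \<in> ?A" for \<omega>
      using that req_random[OF t, of \<omega>] run A_sp by auto
    have "Ev q = {\<omega> \<in> ?A. req t \<omega> = (a, i) \<and> s t \<omega> \<in> B \<and> e t \<omega> \<in> UNIV}"
      using req by (auto simp: Ev_def q(1))
    also have "measure M \<dots> = measure M {\<omega> \<in> ?A. req t \<omega> = (a, i)} * ?P q
        * measure (normal_measure 0 \<sigma>) UNIV"
      using sample_law[OF t sG[of "(a, i)"] _ q(2,3) B, of UNIV] q run by (auto simp: space_in_borel)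
    also have "{\<omega> \<in> ?A. req t \<omega> = (a, i)} = ?A"
      using req by blast
    also have "measure M ?A = measure M A * p t * \<kappa> i"
      using draw_law[OF t A run q(2,3), of True] by simp
    finally show ?thesis
      by (simp add: q(1) normal mult_ac)
  qed
  have "p t * (\<Sum>a\<in>\<Omega>. \<Sum>i=1..K. \<kappa> i * measure N {v \<in> space N. S a (c i) v \<in> B}) * measure M A =
      p t * measure M A * (\<Sum>q\<in>\<Omega> \<times> {1..K}. \<kappa> (snd q) * ?P q)"
    by (simp add: sum.cartesian_product split_def)
  also have "\<dots> = (\<Sum>q\<in>\<Omega> \<times> {1..K}. measure M (Ev q))"
    by (simp only: sum_distrib_left Ev_prob cong: sum.cong)
  also have "\<dots> = measure M (\<Union>q\<in>\<Omega> \<times> {1..K}. Ev q)"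
    using Ev_M cand(2)
    by (intro M.finite_measure_finite_Union[symmetric]) (auto simp: disjoint_family_on_def Ev_def)
  also have "\<dots> \<le> measure M {\<omega> \<in> A. s t \<omega> \<in> B}"
    using hit_M[OF A_G] by (intro M.finite_measure_mono) (auto simp: Ev_def)
  finally show ?thesis .
qed

text \<open>The block consists of the trials \<open>i + 1, ..., i + m\<close>. That they are all
  performed is part of the event, since the conditional laws hold only on performed trials.\<close>

definition missed :: "'a set \<Rightarrow> nat \<Rightarrow> nat \<Rightarrow> 'w set" where
  "missed B i m = {\<omega> \<in> space M. \<forall>t\<in>{i<..i + m}. running \<omega> t \<and> s t \<omega> \<notin> B}"

lemma sets_missed:
  assumes "B \<in> sets borel"
  shows "missed B i m \<in> sets (F (i + m))"
proof -
  have "{\<omega> \<in> space (F (i + m)). running \<omega> t \<and> s t \<omega> \<notin> B} \<in> sets (F (i + m))" if t: "t \<in> {i<..i + m}" for t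
  proof -
    have "{\<omega> \<in> space M. running \<omega> t} \<in> sets (F (i + m))"
    proof -
      have "1 \<le> t" "t - 1 \<le> i + m"
        using t by auto
      then show ?thesis
        using sets_running sets_F_mono by blast
    qed
    moreover have "s t -` (- B) \<inter> space (F t) \<in> sets (F t)"
      using t assms by (intro measurable_sets[OF s_borel] borel_comp) auto
    then have "s t -` (- B) \<inter> space M \<in> sets (F (i + m))"
      using sets_F_mono[of t "i + m"] t by auto
    ultimately have "{\<omega> \<in> space M. running \<omega> t} \<inter> (s t -` (- B) \<inter> space M) \<in> sets (F (i + m))"
      by (rule sets.Int)
    also have "{\<omega> \<in> space M. running \<omega> t} \<inter> (s t -` (- B) \<inter> space M) =
        {\<omega> \<in> space (F (i + m)). running \<omega> t \<and> s t \<omega> \<notin> B}"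
      by auto
    finally show ?thesis .
  qed
  then have "{\<omega> \<in> space (F (i + m)). \<forall>t\<in>{i<..i + m}. running \<omega> t \<and> s t \<omega> \<notin> B} \<in> sets (F (i + m))"
    by (intro sets.sets_Collect_finite_All) auto
  then show ?thesis
    unfolding missed_def space_F .
qed

text \<open>The trials depend on each other, so the induction conditions on the past: given that the
  first \<open>m\<close> trials missed and the next one is performed, that trial misses with
  conditional probability at most \<open>1 - q\<close>.\<close>

lemma prob_missed:
  assumes B: "B \<in> sets borel" and q: "q \<le> 1"
    and q_le: "\<And>t. t \<ge> 1 \<Longrightarrow>
      q \<le> p t * (\<Sum>a\<in>\<Omega>. \<Sum>i=1..K. \<kappa> i * measure N {v \<in> space N. S a (c i) v \<in> B})"
  shows "measure M (missed B i m) \<le> (1 - q) ^ m"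
proof (induction m)
  case 0
  then show ?case by simp
next
  case (Suc m)
  let ?t = "Suc (i + m)"
  \<comment> \<open>Missing in the first \<open>m\<close> trials does not imply that the next one is
    performed, so this is added; the resulting event is still known before trial
    \<open>?t\<close>.\<close>
  define A where "A = missed B i m \<inter> {\<omega> \<in> space M. running \<omega> ?t}"
  have A: "A \<in> sets (F (?t - 1))"
    using sets_missed[OF B, of i m] sets_running[of ?t] by (simp add: A_def sets.Int)
  have run: "running \<omega> ?t" if "\<omega> \<in> A" for \<omega>
    using that by (simp add: A_def)
  have A_M: "A \<in> sets M"
    using A sets_F_in_M by blast
  have s_B: "s ?t -` B \<inter> space M \<in> sets M"
    using measurable_sets[OF s_borel B, of ?t] sets_F_in_M by simp
  have hit: "{\<omega> \<in> A. s ?t \<omega> \<in> B} = A \<inter> (s ?t -` B \<inter> space M)"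
    by (auto simp: A_def)
  have "{i<..i + Suc m} = insert ?t {i<..i + m}"
    by auto
  then have "missed B i (Suc m) = A - {\<omega> \<in> A. s ?t \<omega> \<in> B}"
    by (auto simp: missed_def A_def)
  then have "measure M (missed B i (Suc m)) = measure M A - measure M {\<omega> \<in> A. s ?t \<omega> \<in> B}"
    using A_M s_B by (simp only: hit) (subst M.finite_measure_Diff, auto)
  also have "measure M {\<omega> \<in> A. s ?t \<omega> \<in> B} \<ge> q * measure M A"
    using prob_hit_ge[OF _ A run B] mult_right_mono[OF q_le[of ?t], of "measure M A"] by simp
  then have "measure M A - measure M {\<omega> \<in> A. s ?t \<omega> \<in> B} \<le> (1 - q) * measure M A"
    by (simp add: algebra_simps)
  also have "measure M A \<le> measure M (missed B i m)"
    using sets_missed[OF B] sets_F_in_M by (intro M.finite_measure_mono) (auto simp: A_def)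
  then have "(1 - q) * measure M A \<le> (1 - q) * (1 - q) ^ m"
    using Suc.IH q by (intro mult_left_mono) auto
  finally show ?case by simp
qed

text \<open>A pathwise argument. Half of the admissible variance
  \<open>\<epsilon>\<^sup>2 / \<beta>\<close> pays for the hits being only near \<open>x\<close>,
  the other half for the noise left after \<open>T\<close> exact evaluations; all further data can
  only lower the variance.\<close>

lemma unclassified_empty_if_sampled:
  assumes \<epsilon>: "\<epsilon> > 0" and \<beta>: "\<beta> > 0" and \<omega>: "\<omega> \<in> space M" and n: "n > 0"
    and T: "T > 0" "real T > 2 * \<beta> * \<sigma>\<^sup>2 / \<epsilon>\<^sup>2"
    and close: "\<And>x as. x \<in> \<Omega> \<Longrightarrow> length as = T \<Longrightarrow> set as \<subseteq> nbhd D x \<nu> \<Longrightarrow>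
      \<bar>repeated_var k \<sigma> T x - post_var k \<sigma> as x\<bar> < \<epsilon>\<^sup>2 / (2 * \<beta>)"
    and hits: "\<And>x. x \<in> \<Omega> \<Longrightarrow> \<exists>J\<subseteq>{1..n}. card J = T \<and> (\<forall>t\<in>J. s t \<omega> \<in> nbhd D x \<nu>)"
  shows "unclassified \<omega> n = {}"
proof -
  have "x \<in> HL_set k \<sigma> \<beta> h \<epsilon> \<Omega> (dat n \<omega>)" if x: "x \<in> \<Omega>" for x
  proof (rule HL_set_if_post_var_less[OF x \<epsilon> \<beta>])
    define xs where "xs = map (\<lambda>i. pt i \<omega>) [0..<n0 + n]"
    have xs: "map fst (dat n \<omega>) = xs"
      by (simp add: xs_def dat_eq[OF \<omega>] comp_def del: upt_Suc)
    have xs_D: "set xs \<subseteq> D"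
      using measurable_space[OF pt_measurable, of _ n \<omega>] \<omega>
      by (auto simp: xs_def space_restrict_space simp del: upt_Suc)
    obtain J where J: "J \<subseteq> {1..n}" "card J = T" "\<And>t. t \<in> J \<Longrightarrow> s t \<omega> \<in> nbhd D x \<nu>"
      using hits[OF x] by blast
    then obtain b where b: "bij_betw b {..<T} J"
      using ex_bij_betw_nat_finite[of J] finite_subset[of J "{1..n}"] by (auto simp: lessThan_atLeast0)
    have b_range: "b i \<in> J" "1 \<le> b i" "b i \<le> n" if "i < T" for i
      using bij_betwE[OF b] J(1) that by (auto simp: subset_iff)
    \<comment> \<open>Trial \<open>b i\<close> stands behind the initial data at this position of
      the data list. Subtraction is on naturals, so injectivity relies on
      \<open>1 \<le> b i\<close>.\<close>
    define \<phi> where "\<phi> i = n0 + (b i - 1)" for i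
    have \<phi>_inj: "inj_on \<phi> {..<T}"
    proof (rule inj_onI)
      fix i j assume "i \<in> {..<T}" "j \<in> {..<T}" "\<phi> i = \<phi> j"
      moreover from this have "b i = b j"
        using b_range(2)[of i] b_range(2)[of j] by (simp add: \<phi>_def)
      ultimately show "i = j"
        using bij_betw_imp_inj_on[OF b] by (simp add: inj_on_eq_iff)
    qed
    have \<phi>_less: "\<phi> i < n0 + n" if "i < T" for i
      using b_range[OF that] n by (auto simp: \<phi>_def)
    have nth: "xs ! \<phi> i = s (b i) \<omega>" if "i < T" for i
    proof -
      have "pt (\<phi> i) = s (b i)"
        using b_range(2)[OF that] by (cases "b i") (auto simp: pt_def \<phi>_def)
      then show ?thesis
        using \<phi>_less[OF that] by (simp add: xs_def del: upt_Suc)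
    qed
    let ?ys = "map (\<lambda>i. xs ! \<phi> i) [0..<T]"
    have "set ?ys \<subseteq> nbhd D x \<nu>"
      using nth J(3) b_range by auto
    then have "post_var k \<sigma> ?ys x < repeated_var k \<sigma> T x + \<epsilon>\<^sup>2 / (2 * \<beta>)"
      using close[OF x, of ?ys] by auto
    moreover have "post_var k \<sigma> xs x \<le> post_var k \<sigma> ?ys x"
      using \<phi>_less by (intro post_var_mono[OF kernel xs_D noise_sd \<phi>_inj]) (auto simp: xs_def)
    moreover have "repeated_var k \<sigma> T x \<le> \<sigma>\<^sup>2 / real T"
      using repeated_var_le[OF kernel _ noise_sd T(1)] x cand(1) by auto
    moreover have "\<sigma>\<^sup>2 / real T < \<epsilon>\<^sup>2 / (2 * \<beta>)"
      using T \<epsilon> \<beta> by (simp add: field_simps)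
    moreover have "\<epsilon>\<^sup>2 / (2 * \<beta>) + \<epsilon>\<^sup>2 / (2 * \<beta>) = \<epsilon>\<^sup>2 / \<beta>"
      by simp
    ultimately show "post_var k \<sigma> (map fst (dat n \<omega>)) x < \<epsilon>\<^sup>2 / \<beta>"
      unfolding xs by linarith
  qed
  then show ?thesis
    using n by (auto simp: U_set_def)
qed

section \<open>Completion time and the union bound over blocks\<close>

lemma completed_eq:
  "{\<omega> \<in> space M. \<exists>t\<le>n. completes_after k \<sigma> \<beta> h \<epsilon> \<Omega> (\<lambda>j. dat j \<omega>) t} =
    space M - {\<omega> \<in> space M. \<forall>t\<le>n. unclassified \<omega> t \<noteq> {}}"
proof -
  have "(\<exists>t\<le>n. completes_after k \<sigma> \<beta> h \<epsilon> \<Omega> (\<lambda>j. dat j \<omega>) t) \<longleftrightarrow> (\<exists>t\<le>n. unclassified \<omega> t = {})" for \<omega>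
  proof
    assume "\<exists>t\<le>n. unclassified \<omega> t = {}"
    then obtain t where t: "t \<le> n" "unclassified \<omega> t = {}" by blast
    let ?t = "LEAST t. unclassified \<omega> t = {}"
    have "unclassified \<omega> ?t = {}" "?t \<le> t" "\<forall>j<?t. unclassified \<omega> j \<noteq> {}"
      using LeastI[of "\<lambda>t. unclassified \<omega> t = {}", OF t(2)]
        Least_le[of "\<lambda>t. unclassified \<omega> t = {}", OF t(2)]
        not_less_Least[of _ "\<lambda>t. unclassified \<omega> t = {}"] by blast+
    with t(1) show "\<exists>t\<le>n. completes_after k \<sigma> \<beta> h \<epsilon> \<Omega> (\<lambda>j. dat j \<omega>) t"
      unfolding completes_after_def by (meson le_trans)
  qed (auto simp: completes_after_def)
  then show ?thesis by blast
qed

lemma sets_not_completed: "{\<omega> \<in> space M. \<forall>t\<le>n. unclassified \<omega> t \<noteq> {}} \<in> sets M"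
proof -
  have "{\<omega> \<in> space M. \<forall>t\<in>{..n}. unclassified \<omega> t \<noteq> {}} \<in> sets M"
    using sets_unclassified sets_F_in_M by (intro sets.sets_Collect_finite_All) auto
  then show ?thesis
    unfolding Ball_def atMost_iff .
qed

lemma prob_completes:
  assumes \<epsilon>: "\<epsilon> > 0" and \<beta>: "\<beta> > 0"
    and T: "T > 0" "real T > 2 * \<beta> * \<sigma>\<^sup>2 / \<epsilon>\<^sup>2"
    and close: "\<And>x as. x \<in> \<Omega> \<Longrightarrow> length as = T \<Longrightarrow> set as \<subseteq> nbhd D x \<nu> \<Longrightarrow>
      \<bar>repeated_var k \<sigma> T x - post_var k \<sigma> as x\<bar> < \<epsilon>\<^sup>2 / (2 * \<beta>)"
    and q: "q \<le> 1"
    and q_le: "\<And>t x. t \<ge> 1 \<Longrightarrow> x \<in> \<Omega> \<Longrightarrow> q \<le> p t *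
      (\<Sum>a\<in>\<Omega>. \<Sum>i=1..K. \<kappa> i * measure N {v \<in> space N. S a (c i) v \<in> nbhd D x \<nu>})"
    and R: "R > 0"
  shows "measure M {\<omega> \<in> space M. \<exists>t \<le> R * card \<Omega> * T.
      completes_after k \<sigma> \<beta> h \<epsilon> \<Omega> (\<lambda>j. dat j \<omega>) t} \<ge> 1 - real (card \<Omega>) * real T * (1 - q) ^ R"
proof -
  let ?n = "R * card \<Omega> * T"
  define W where "W = {\<omega> \<in> space M. \<forall>t\<le>?n. unclassified \<omega> t \<noteq> {}}"
  obtain idx where idx: "bij_betw idx \<Omega> {..<card \<Omega>}"
    using ex_bij_betw_finite_nat[OF cand(2)] by (auto simp: lessThan_atLeast0)
  \<comment> \<open>\<open>st x j\<close> counts the trials before block \<open>j\<close> of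
    candidate \<open>x\<close>, so that block is \<open>st x j + 1, ..., st x j + R\<close>. As
    \<open>idx\<close> numbers the candidates from 0, the \<open>card \<Omega> * T\<close> blocks
    tile the first \<open>?n\<close> trials.\<close>
  define st where "st x j = (idx x * T + j) * R" for x j
  have st_le: "st x j + R \<le> ?n" if "x \<in> \<Omega>" "j < T" for x j
  proof -
    have "Suc (idx x) \<le> card \<Omega>"
      using bij_betwE[OF idx] that(1) by (auto simp: Suc_le_eq)
    have "idx x * T + j + 1 \<le> Suc (idx x) * T"
      using that(2) by simp
    also have "\<dots> \<le> card \<Omega> * T"
      using \<open>Suc (idx x) \<le> card \<Omega>\<close> by (rule mult_le_mono1)
    finally have "(idx x * T + j + 1) * R \<le> (card \<Omega> * T) * R"
      by (rule mult_le_mono1)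
    then show ?thesis by (simp add: st_def algebra_simps)
  qed
  have st_less: "st x j + R \<le> st x j'" if "j < j'" for x j j'
  proof -
    have "(idx x * T + j + 1) * R \<le> (idx x * T + j') * R"
      using that by (intro mult_le_mono1) simp
    then show ?thesis by (simp add: st_def algebra_simps)
  qed
  \<comment> \<open>Outside the union, every block of an unfinished path contains a hit of its ball.
    This gives \<open>T\<close> distinct hits per candidate, hence an empty unclassified set at
    \<open>?n\<close>, a contradiction.\<close>
  have "W \<subseteq> (\<Union>(x, j)\<in>\<Omega> \<times> {..<T}. missed (ball x \<nu>) (st x j) R)"
  proof (rule ccontr)
    assume "\<not> ?thesis"
    then obtain \<omega> where W: "\<omega> \<in> W"
      and nm: "\<And>x j. x \<in> \<Omega> \<Longrightarrow> j < T \<Longrightarrow> \<omega> \<notin> missed (ball x \<nu>) (st x j) R"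
      by auto
    have \<omega>: "\<omega> \<in> space M" and U: "\<And>t. t \<le> ?n \<Longrightarrow> unclassified \<omega> t \<noteq> {}"
      using W by (auto simp: W_def)
    have "unclassified \<omega> ?n = {}"
    proof (rule unclassified_empty_if_sampled[OF \<epsilon> \<beta> \<omega> _ T close])
      show "?n > 0" using R T(1) cand by (simp add: card_gt_0_iff)
    next
      fix x assume x: "x \<in> \<Omega>"
      have "\<exists>t. st x j < t \<and> t \<le> st x j + R \<and> s t \<omega> \<in> nbhd D x \<nu>" if j: "j < T" for j
      proof -
        obtain t where t: "st x j < t" "t \<le> st x j + R" "\<not> (running \<omega> t \<and> s t \<omega> \<notin> ball x \<nu>)"
          using nm[OF x j] \<omega> by (auto simp: missed_def)
        \<comment> \<open>The path does not stop by \<open>?n\<close>, so all trials of the block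
          are performed, and a block that is not \<open>missed\<close> must contain a hit.\<close>
        have "running \<omega> t"
          using U t(2) st_le[OF x j] by (auto simp: performed_def)
        then have "s t \<omega> \<in> nbhd D x \<nu>"
          using t s_in_D[of t \<omega>] \<omega> by (auto simp: nbhd_def dist_norm norm_minus_commute)
        with t show ?thesis by blast
      qed
      then obtain \<tau> where \<tau>: "\<And>j. j < T \<Longrightarrow> st x j < \<tau> j" "\<And>j. j < T \<Longrightarrow> \<tau> j \<le> st x j + R"
          "\<And>j. j < T \<Longrightarrow> s (\<tau> j) \<omega> \<in> nbhd D x \<nu>"
        by metis
      \<comment> \<open>The blocks of one candidate are ordered without overlap, which makes the
        chosen trials distinct.\<close>
      have lt: "\<tau> j < \<tau> j'" if "j < j'" "j' < T" for j j'
        using \<tau>(2)[of j] \<tau>(1)[of j'] st_less[OF that(1), of x] that by linarith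
      have "inj_on \<tau> {..<T}"
        by (rule linorder_inj_onI) (auto dest: lt)
      then have "card (\<tau> ` {..<T}) = T"
        by (simp add: card_image)
      moreover have "1 \<le> \<tau> j" "\<tau> j \<le> ?n" if "j < T" for j
        using \<tau>(1,2)[OF that] st_le[OF x that] by linarith+
      ultimately show "\<exists>J\<subseteq>{1..?n}. card J = T \<and> (\<forall>t\<in>J. s t \<omega> \<in> nbhd D x \<nu>)"
        using \<tau>(3) by (intro exI[of _ "\<tau> ` {..<T}"]) auto
    qed
    with U show False by blast
  qed
  moreover have missed_M: "missed (ball x \<nu>) i m \<in> sets M" for x i m
    by (rule sets_F_in_M[OF sets_missed[OF borel_open]]) simp
  ultimately have "measure M W \<le> measure M (\<Union>(x, j)\<in>\<Omega> \<times> {..<T}. missed (ball x \<nu>) (st x j) R)"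
    using cand(2) missed_M by (intro M.finite_measure_mono sets.finite_UN) auto
  also have "\<dots> \<le> (\<Sum>(x, j)\<in>\<Omega> \<times> {..<T}. measure M (missed (ball x \<nu>) (st x j) R))"
    using M.finite_measure_subadditive_finite[of "\<Omega> \<times> {..<T}" "\<lambda>(x, j). missed (ball x \<nu>) (st x j) R"]
      cand(2) missed_M by (auto simp: split_def image_subset_iff)
  also have "\<dots> \<le> (\<Sum>(x, j)\<in>\<Omega> \<times> {..<T}. (1 - q) ^ R)"
  proof (intro sum_mono, clarify)
    fix x j assume x: "x \<in> \<Omega>"
    \<comment> \<open>\<open>D\<close> need not be Borel, so the laws are applied to the open ball
      instead of \<open>nbhd D x \<nu>\<close>; both give the same events because samples lie in
      \<open>D\<close>.\<close>
    have "{v \<in> space N. S a (c i) v \<in> nbhd D x \<nu>} = {v \<in> space N. S a (c i) v \<in> ball x \<nu>}"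
      if "a \<in> \<Omega>" "i \<in> {1..K}" for a i
      using S_in_D[OF that] by (auto simp: nbhd_def dist_norm norm_minus_commute)
    then have "(\<Sum>a\<in>\<Omega>. \<Sum>i=1..K. \<kappa> i * measure N {v \<in> space N. S a (c i) v \<in> nbhd D x \<nu>}) =
        (\<Sum>a\<in>\<Omega>. \<Sum>i=1..K. \<kappa> i * measure N {v \<in> space N. S a (c i) v \<in> ball x \<nu>})"
      by (auto intro!: sum.cong)
    then show "measure M (missed (ball x \<nu>) (st x j) R) \<le> (1 - q) ^ R"
      using q q_le[OF _ x] by (intro prob_missed borel_open) auto
  qed
  also have "\<dots> = real (card \<Omega>) * real T * (1 - q) ^ R"
    by (simp add: card_cartesian_product)
  finally have "measure M W \<le> real (card \<Omega>) * real T * (1 - q) ^ R" .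
  moreover have "measure M (space M - W) = 1 - measure M W"
    using sets_not_completed by (intro M.prob_compl) (simp add: W_def)
  ultimately show ?thesis
    unfolding completed_eq W_def[symmetric] by simp
qed

end

section \<open>Choice of the constants and the final bound\<close>

theorem theorem4:
  fixes D \<Omega> :: "'a::euclidean_space set"
    and k :: "'a \<Rightarrow> 'a \<Rightarrow> real" and \<sigma> h \<epsilon> \<beta> :: real
    and K :: nat and c \<kappa> p :: "nat \<Rightarrow> real"
    and N :: "'v measure" and S :: "'a \<Rightarrow> real \<Rightarrow> 'v \<Rightarrow> 'a" and g :: "'a \<Rightarrow> real \<Rightarrow> 'a \<Rightarrow> real"
    and M :: "'w measure" and f :: "'w \<Rightarrow> 'a \<Rightarrow> real"
    and n0 :: nat and E F G :: "nat \<Rightarrow> 'w measure"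
    and s0 s :: "nat \<Rightarrow> 'w \<Rightarrow> 'a" and e0 e :: "nat \<Rightarrow> 'w \<Rightarrow> real"
    and r :: "nat \<Rightarrow> 'w \<Rightarrow> bool" and C req :: "nat \<Rightarrow> 'w \<Rightarrow> 'a \<times> nat"
    and HL0 :: "'w \<Rightarrow> 'a set" and dat :: "nat \<Rightarrow> 'w \<Rightarrow> ('a \<times> real) list"
    and p_star \<delta> \<nu> p_tilde_star q :: real and p_tilde :: "'a \<Rightarrow> real"
    and T_star R :: nat
  assumes algorithm: "lse_run D \<Omega> k \<sigma> K c N S g \<beta> h \<epsilon> p \<kappa> M f n0 E s0 e0 F G r C req s e HL0 dat"
    and eps: "\<epsilon> > 0" and beta: "\<beta> > 0"
    and A1': "p_star \<in> {0<..<1}" "\<forall>t\<ge>1. p_star \<le> p t"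
    and A2: "\<forall>x\<in>\<Omega>. \<forall>\<eta>>0. \<exists>x'\<in>\<Omega>. \<exists>i\<in>{1..K}.
          measure N {v \<in> space N. S x' (c i) v \<in> nbhd D x \<eta>} > 0"
    and A3: "\<forall>x\<in>\<Omega>. continuous (at (x, x) within D \<times> D) (\<lambda>(a, b). k a b)"
    and delta: "\<delta> \<in> {0<..<1}"
    and T_star: "T_star = (LEAST n. 0 < n \<and> real n > 2 * \<beta> * \<sigma>\<^sup>2 / \<epsilon>\<^sup>2)"
    and nu: "\<nu> > 0"
      "\<forall>x\<in>\<Omega>. \<forall>as. length as = T_star \<and> set as \<subseteq> nbhd D x \<nu> \<longrightarrow>
          \<bar>repeated_var k \<sigma> T_star x - post_var k \<sigma> as x\<bar> < \<epsilon>\<^sup>2 / (2 * \<beta>)"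
    and p_tilde: "\<forall>x\<in>\<Omega>. p_tilde x =
          (\<Sum>a\<in>\<Omega>. \<Sum>i=1..K. \<kappa> i * measure N {v \<in> space N. S a (c i) v \<in> nbhd D x \<nu>})"
    and p_tilde_star: "p_tilde_star = Min (p_tilde ` \<Omega>)"
    and q: "q = p_star * p_tilde_star"
    and R: "R = (LEAST n. 0 < n \<and>
          real n > ln (real (card \<Omega>) * real T_star / \<delta>) / (- ln (1 - q)))"
  shows "measure M {\<omega> \<in> space M.
           \<exists>t \<le> R * card \<Omega> * T_star. completes_after k \<sigma> \<beta> h \<epsilon> \<Omega> (\<lambda>j. dat j \<omega>) t} \<ge> 1 - \<delta>"
proof -
  interpret lse_run D \<Omega> k \<sigma> K c N S g \<beta> h \<epsilon> p \<kappa> M f n0 E s0 e0 F G r C req s e HL0 dat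
    by (rule algorithm)
  let ?P = "\<lambda>x a i. measure N {v \<in> space N. S a (c i) v \<in> nbhd D x \<nu>}"
  \<comment> \<open>A \<open>LEAST\<close> value has its defining property only if some number
    qualifies; the Archimedean property provides one, here and for \<open>R\<close>.\<close>
  have T: "0 < T_star \<and> real T_star > 2 * \<beta> * \<sigma>\<^sup>2 / \<epsilon>\<^sup>2"
  proof -
    obtain n where "real n > max 0 (2 * \<beta> * \<sigma>\<^sup>2 / \<epsilon>\<^sup>2)"
      using reals_Archimedean2 by blast
    then have "\<exists>n. 0 < n \<and> real n > 2 * \<beta> * \<sigma>\<^sup>2 / \<epsilon>\<^sup>2"
      by (intro exI[of _ n]) auto
    then show ?thesis
      unfolding T_star by (rule LeastI_ex)
  qed
  have R_props: "0 < R \<and> real R > ln (real (card \<Omega>) * real T_star / \<delta>) / (- ln (1 - q))"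
  proof -
    obtain n where "real n > max 0 (ln (real (card \<Omega>) * real T_star / \<delta>) / (- ln (1 - q)))"
      using reals_Archimedean2 by blast
    then have "\<exists>n. 0 < n \<and> real n > ln (real (card \<Omega>) * real T_star / \<delta>) / (- ln (1 - q))"
      by (intro exI[of _ n]) auto
    then show ?thesis
      unfolding R by (rule LeastI_ex)
  qed
  have \<kappa>_pos: "\<kappa> i > 0" if "i \<in> {1..K}" for i
    using \<kappa>_range[OF that] by simp
  \<comment> \<open>\<open>A2\<close> at radius \<open>\<nu>\<close> supplies one request with
    positive hitting probability; its weight is positive and no other summand is negative.\<close>
  have pt_pos: "p_tilde x > 0" if x: "x \<in> \<Omega>" for x
  proof -
    obtain a i where ai: "a \<in> \<Omega>" "i \<in> {1..K}" "?P x a i > 0"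
      using A2 x nu(1) by blast
    have nonneg: "0 \<le> \<kappa> j * ?P x b j" if "j \<in> {1..K}" for b j
      using \<kappa>_pos[OF that] by simp
    have "0 < \<kappa> i * ?P x a i"
      using \<kappa>_pos[OF ai(2)] ai(3) by simp
    also have "\<dots> \<le> (\<Sum>i=1..K. \<kappa> i * ?P x a i)"
      using ai(2) nonneg by (intro member_le_sum) auto
    also have "\<dots> \<le> (\<Sum>a\<in>\<Omega>. \<Sum>i=1..K. \<kappa> i * ?P x a i)"
      using ai(1) nonneg cand(2) by (intro member_le_sum[of a \<Omega> "\<lambda>a. \<Sum>i=1..K. \<kappa> i * ?P x a i"] sum_nonneg) auto
    finally show ?thesis using p_tilde x by simp
  qed
  \<comment> \<open>The weights \<open>\<kappa> i\<close> form a probability distribution on the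
    requests, so \<open>p_tilde x\<close> is an average of probabilities.\<close>
  have pt_le: "p_tilde x \<le> 1" if x: "x \<in> \<Omega>" for x
  proof -
    have "p_tilde x \<le> (\<Sum>a\<in>\<Omega>. \<Sum>i=1..K. \<kappa> i * 1)"
      unfolding p_tilde[rule_format, OF x]
      using less_imp_le[OF \<kappa>_pos] by (intro sum_mono mult_left_mono N.prob_le_1) auto
    also have "\<dots> = 1"
      using \<kappa>_sum by simp
    finally show ?thesis .
  qed
  have fin: "finite (p_tilde ` \<Omega>)" "p_tilde ` \<Omega> \<noteq> {}"
    using cand by auto
  have "p_tilde_star \<in> p_tilde ` \<Omega>"
    unfolding p_tilde_star by (rule Min_in[OF fin])
  then have star: "0 < p_tilde_star" "p_tilde_star \<le> 1"
    using pt_pos pt_le by auto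
  have star_le: "p_tilde_star \<le> p_tilde x" if "x \<in> \<Omega>" for x
    unfolding p_tilde_star using fin that by (intro Min_le) auto
  have q_pos: "q > 0"
    using A1'(1) star by (simp add: q)
  \<comment> \<open>Strictness in \<open>q < 1\<close> comes from \<open>p_star < 1\<close>, as
    \<open>p_tilde_star\<close> may equal 1; it makes \<open>1 - q\<close> positive, so that its
    logarithm can be used.\<close>
  have "q \<le> p_star * 1"
    unfolding q using A1'(1) star by (intro mult_left_mono) auto
  then have q_less: "q < 1"
    using A1'(1) by simp
  have "1 - real (card \<Omega>) * real T_star * (1 - q) ^ R \<le> measure M {\<omega> \<in> space M.
      \<exists>t \<le> R * card \<Omega> * T_star. completes_after k \<sigma> \<beta> h \<epsilon> \<Omega> (\<lambda>j. dat j \<omega>) t}"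
  proof (rule prob_completes[OF eps beta _ _ _ less_imp_le[OF q_less]])
    fix t x assume t: "t \<ge> (1::nat)" and x: "x \<in> \<Omega>"
    have "q \<le> p t * p_tilde x"
      unfolding q using A1' star star_le[OF x] t by (intro mult_mono) force+
    then show "q \<le> p t * (\<Sum>a\<in>\<Omega>. \<Sum>i=1..K. \<kappa> i * ?P x a i)"
      using p_tilde x by simp
  qed (use T R_props nu in auto)
  moreover have "real (card \<Omega>) * real T_star * (1 - q) ^ R \<le> \<delta>"
  proof -
    let ?m = "real (card \<Omega>) * real T_star"
    have m: "?m > 0"
      using T cand by (simp add: card_gt_0_iff)
    \<comment> \<open>As \<open>- ln (1 - q)\<close> is positive, the defining inequality of
      \<open>R\<close> may be multiplied by it; exponentiated, it says that the union bound is below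
      \<open>\<delta>\<close>.\<close>
    have "ln (1 - q) < 0"
      using q_pos q_less by simp
    then have "ln (?m / \<delta>) < real R * (- ln (1 - q))"
      using R_props pos_divide_less_eq[of "- ln (1 - q)" "ln (?m / \<delta>)" "real R"] by linarith
    then have "ln ?m + real R * ln (1 - q) < ln \<delta>"
      using ln_divide_pos[of ?m \<delta>] m delta by simp
    then have "ln (?m * (1 - q) ^ R) < ln \<delta>"
      using ln_mult_pos[of ?m "(1 - q) ^ R"] m q_less by (simp add: ln_realpow)
    then show ?thesis
      using m q_less delta by (subst (asm) ln_less_cancel_iff) auto
  qed
  ultimately show ?thesis by linarith
qed

end
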